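(* Suppose $\kappa>0$, $\rho^0\in\mathcal P(\mathbf S\mathfrak H)$ and $\mathcal D[\rho^0]<\tfrac12$, and let $\rho$ be a Lagrangian weak solution of $$\partial_t\rho+\frac{\kappa}{2}\operatorname{div}_\phi\Big(\rho\int_{\mathbf S\mathfrak H}\big(\tilde\phi-\langle\phi|\tilde\phi\rangle\phi\big)\rho(t,d\tilde\phi)\Big)=0,\qquad \rho|_{t=0}=\rho^0 .$$ Then $\mathcal D[\rho(t)]$ decays to zero exponentially fast as $t\to\infty$: $$\mathcal D[\rho(t)]\le\frac{\mathcal D[\rho^0]}{(1-2\mathcal D[\rho^0])\,e^{\frac{\kappa}{2}t}+2\mathcal D[\rho^0]},\qquad t\ge0 .$$
   Context: $\mathbb T^d=\mathbb R^d/\mathbb Z^d$; $\mathfrak H=L^2(\mathbb T^d)$ (complex-valued) with $\langle\psi|\chi\rangle=\int_{\mathbb T^d}\psi\,\overline{\chi}\,dx$ and norm $\|\cdot\|_{\mathfrak H}$; $\mathbf S\mathfrak H$ is the unit sphere of $\mathfrak H$; $\mathcal P(\mathbf S\mathfrak H)$ is the set of Borel probability measures on $\mathbf S\mathfrak H$. A Lagrangian weak solution is a continuous curve $t\mapsto\rho(t)\in\mathcal P(\mathbf S\mathfrak H)$, $t\ge0$, such that $\rho(t)=\mathcal S(t)\#\rho^0$ (push-forward), where $\mathcal S(t)\phi^0=\phi(t)$ is the flow on $\mathbf S\mathfrak H$ of $$\dot\phi(t)=\frac{\kappa}{2}\int_{\mathbf S\mathfrak H}\big(\tilde\phi-\langle\phi(t)|\tilde\phi\rangle\phi(t)\big)\rho(t,d\tilde\phi),\qquad\phi(0)=\phi^0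 .$$ The diameter is $\mathcal D[\rho]:=\sup\{\|\phi-\tilde\phi\|_{\mathfrak H}:\phi,\tilde\phi\in\operatorname{supp}\rho\}$. *)

theory Defs
  imports "HOL-Probability.Probability"
begin

section \<open>The torus\<close>

quotient_type 'n torus = "real ^ 'n" / "\<lambda>x y. \<forall>i. x $ i - y $ i \<in> \<int>"
proof (rule equivpI)
  show "reflp (\<lambda>x y :: real ^ 'n. \<forall>i. x $ i - y $ i \<in> \<int>)"
    by (simp add: reflp_def)
  show "symp (\<lambda>x y :: real ^ 'n. \<forall>i. x $ i - y $ i \<in> \<int>)"
    unfolding symp_def by (metis Ints_minus minus_diff_eq)
  show "transp (\<lambda>x y :: real ^ 'n. \<forall>i. x $ i - y $ i \<in> \<int>)"
    unfolding transp_def using Ints_add[of "x $ i - y $ i" "y $ i - z $ i" for x y z :: "real ^ 'n" and i]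
    by fastforce
qed

text \<open>The quotient topology.\<close>

instantiation torus :: (finite) topological_space
begin

definition open_torus :: "'a torus set \<Rightarrow> bool"
  where "open_torus U \<longleftrightarrow> open (abs_torus -` U)"

instance
proof
  show "open (UNIV :: 'a torus set)"
    by (simp add: open_torus_def)
  show "open (S \<inter> T)" if "open S" "open T" for S T :: "'a torus set"
    using that by (auto simp: open_torus_def)
  show "open (\<Union> K)" if "\<forall>S\<in>K. open S" for K :: "'a torus set set"
    using that by (auto simp: open_torus_def vimage_Union)
qed

end

lemma continuous_on_abs_torus: "continuous_on UNIV (abs_torus :: real ^ 'n \<Rightarrow> 'n::finite torus)"
  by (auto simp: continuous_on_open_vimage open_torus_def)

lemma measurable_abs_torus [measurable]:
  "(abs_torus :: real ^ 'n \<Rightarrow> 'n::finite torus) \<in> borel_measurable borel"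
  by (rule borel_measurable_continuous_onI[OF continuous_on_abs_torus])

lemma abs_torus_eq_iff:
  "abs_torus x = abs_torus y \<longleftrightarrow> (\<forall>i. x $ i - y $ i \<in> \<int>)"
  using torus.abs_eq_iff by blast

lemma open_abs_torus_image:
  fixes b :: "(real ^ 'n::finite) set"
  assumes "open b"
  shows "open (abs_torus ` b)"
proof -
  have "abs_torus -` (abs_torus ` b) = (\<Union>z\<in>{z. \<forall>i. z $ i \<in> \<int>}. (+) z ` b)" (is "?L = ?R")
  proof
    show "?L \<subseteq> ?R"
    proof
      fix x assume "x \<in> ?L"
      then obtain y where y: "y \<in> b" "abs_torus x = abs_torus y" by auto
      then have "\<forall>i. (x - y) $ i \<in> \<int>" by (simp add: abs_torus_eq_iff)
      moreover have "x = (x - y) + y" by simp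
      ultimately show "x \<in> ?R" using y(1) by blast
    qed
    show "?R \<subseteq> ?L"
    proof
      fix x assume "x \<in> ?R"
      then obtain z y where "\<forall>i. z $ i \<in> \<int>" "y \<in> b" "x = z + y" by auto
      then have "abs_torus x = abs_torus y" by (simp add: abs_torus_eq_iff)
      with \<open>y \<in> b\<close> show "x \<in> ?L" by auto
    qed
  qed
  moreover have "open ?R"
    by (intro open_UN ballI open_translation assms)
  ultimately show ?thesis
    by (simp add: open_torus_def)
qed

instance torus :: (finite) second_countable_topology
proof
  obtain B :: "(real ^ 'a) set set" where B: "countable B" "topological_basis B"
    using ex_countable_basis by blast
  let ?B = "(\<lambda>b. abs_torus ` b) ` B"
  have "topological_basis ?B"
  proof (rule topological_basisI)
    show "open b'" if "b' \<in> ?B" for b'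
      using that topological_basis_open[OF B(2)] open_abs_torus_image by auto
  next
    fix U :: "'a torus set" and p assume U: "open U" "p \<in> U"
    have "\<exists>x. p = abs_torus x"
      by (induction p rule: torus.abs_induct) blast
    then obtain x where x: "p = abs_torus x" by blast
    have "open (abs_torus -` U)" "x \<in> abs_torus -` U"
      using U x by (auto simp: open_torus_def)
    then obtain b where "b \<in> B" "x \<in> b" "b \<subseteq> abs_torus -` U"
      using topological_basisE[OF B(2)] by metis
    then show "\<exists>b'\<in>?B. p \<in> b' \<and> b' \<subseteq> U"
      using x by auto
  qed
  then show "\<exists>B :: 'a torus set set. countable B \<and> open = generate_topology B"
    using B(1) topological_basis_imp_subbasis by blast
qed

text \<open>Lebesgue measure of a fundamental domain, carried to the torus.\<close>

definition torus_measure :: "'n::finite torus measure" where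
  "torus_measure =
     distr (restrict_space lborel {x :: real ^ 'n. \<forall>i. 0 \<le> x $ i \<and> x $ i < 1}) borel abs_torus"

lemma sets_torus_measure [simp, measurable_cong]: "sets torus_measure = sets borel"
  by (simp add: torus_measure_def)

lemma space_torus_measure [simp]: "space torus_measure = UNIV"
  by (simp add: torus_measure_def)

lemma finite_measure_torus: "finite_measure (torus_measure :: 'n::finite torus measure)"
proof -
  let ?Q = "{x :: real ^ 'n. \<forall>i. 0 \<le> x $ i \<and> x $ i < 1}"
  have Q: "?Q \<in> sets lborel" by measurable
  have "?Q \<subseteq> cbox 0 1"
    by (auto simp: mem_box_cart less_imp_le)
  then have "emeasure lborel ?Q \<le> emeasure lborel (cbox 0 1 :: (real ^ 'n) set)"
    by (intro emeasure_mono) auto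
  also have "\<dots> < \<infinity>"
    by (rule emeasure_lborel_cbox_finite)
  finally have *: "emeasure lborel ?Q < \<infinity>" .
  have "finite_measure (restrict_space lborel ?Q)"
    using * Q by (intro finite_measureI) (auto simp: emeasure_restrict_space space_restrict_space)
  then show ?thesis
    unfolding torus_measure_def
    by (intro finite_measure.finite_measure_distr) (auto intro: measurable_restrict_space1)
qed

section \<open>Complex square integrable functions on the torus, modulo null sets\<close>

definition square_integrable :: "('n::finite torus \<Rightarrow> complex) \<Rightarrow> bool" where
  "square_integrable f \<longleftrightarrow>
     f \<in> borel_measurable torus_measure \<and> integrable torus_measure (\<lambda>x. (cmod (f x))\<^sup>2)"

lemma square_integrable_cmult:
  "square_integrable f \<Longrightarrow> square_integrable (\<lambda>x. c * f x)"
  by (auto simp: square_integrable_def norm_mult power_mult_distrib)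

lemma square_integrable_add:
  assumes "square_integrable f" "square_integrable g"
  shows "square_integrable (\<lambda>x. f x + g x)"
proof -
  have [measurable]: "f \<in> borel_measurable torus_measure" "g \<in> borel_measurable torus_measure"
    using assms by (auto simp: square_integrable_def)
  have "integrable torus_measure (\<lambda>x. (cmod (f x + g x))\<^sup>2)"
  proof (rule Bochner_Integration.integrable_bound)
    show "integrable torus_measure (\<lambda>x. 2 * (cmod (f x))\<^sup>2 + 2 * (cmod (g x))\<^sup>2)"
      using assms by (auto simp: square_integrable_def)
    have "(cmod (a + b))\<^sup>2 \<le> 2 * (cmod a)\<^sup>2 + 2 * (cmod b)\<^sup>2" for a b
    proof -
      have "(cmod (a + b))\<^sup>2 \<le> (cmod a + cmod b)\<^sup>2"
        by (intro power_mono norm_triangle_ineq) simp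
      also have "\<dots> \<le> 2 * (cmod a)\<^sup>2 + 2 * (cmod b)\<^sup>2"
        using sum_squares_bound[of "cmod a" "cmod b"] by (simp add: power2_sum)
      finally show ?thesis .
    qed
    then show "AE x in torus_measure. norm ((cmod (f x + g x))\<^sup>2)
        \<le> norm (2 * (cmod (f x))\<^sup>2 + 2 * (cmod (g x))\<^sup>2)"
      by (auto simp: abs_of_nonneg intro!: AE_I2)
  qed measurable
  then show ?thesis by (simp add: square_integrable_def)
qed

lemma square_integrable_diff:
  assumes "square_integrable f" "square_integrable g"
  shows "square_integrable (\<lambda>x. f x - g x)"
  using square_integrable_add[OF assms(1) square_integrable_cmult[OF assms(2), of "-1"]] by simp

lemma square_integrable_bounded:
  assumes [measurable]: "f \<in> borel_measurable torus_measure" and "\<And>x. cmod (f x) \<le> B"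
  shows "square_integrable f"
proof -
  interpret finite_measure torus_measure by (rule finite_measure_torus)
  have "integrable torus_measure (\<lambda>x. (cmod (f x))\<^sup>2)"
    by (rule integrable_const_bound[where B = "B\<^sup>2"]) (auto intro!: power_mono assms(2))
  then show ?thesis by (simp add: square_integrable_def)
qed

lemma borel_measurable_cnj [measurable]:
  "f \<in> borel_measurable M \<Longrightarrow> (\<lambda>x. cnj (f x)) \<in> borel_measurable M"
  by (rule borel_measurable_continuous_on) (auto intro: continuous_intros)

lemma integrable_mult_cnj:
  assumes "square_integrable f" "square_integrable g"
  shows "integrable torus_measure (\<lambda>x. f x * cnj (g x))"
proof -
  have [measurable]: "f \<in> borel_measurable torus_measure" "g \<in> borel_measurable torus_measure"
    using assms by (auto simp: square_integrable_def)
  show ?thesis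
  proof (rule Bochner_Integration.integrable_bound)
    show "integrable torus_measure (\<lambda>x. (cmod (f x))\<^sup>2 + (cmod (g x))\<^sup>2)"
      using assms by (auto simp: square_integrable_def)
    have "cmod a * cmod b \<le> (cmod a)\<^sup>2 + (cmod b)\<^sup>2" for a b
    proof -
      have "2 * (cmod a * cmod b) \<le> (cmod a)\<^sup>2 + (cmod b)\<^sup>2"
        unfolding mult.assoc[symmetric] by (rule sum_squares_bound)
      moreover have "0 \<le> cmod a * cmod b" by simp
      ultimately show ?thesis by linarith
    qed
    then show "AE x in torus_measure. norm (f x * cnj (g x))
        \<le> norm ((cmod (f x))\<^sup>2 + (cmod (g x))\<^sup>2)"
      by (auto simp: norm_mult intro!: AE_I2)
  qed measurable
qed

definition L2_rel :: "('n::finite torus \<Rightarrow> complex) \<Rightarrow> ('n torus \<Rightarrow> complex) \<Rightarrow> bool" where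
  "L2_rel f g \<longleftrightarrow> square_integrable f \<and> square_integrable g \<and> (AE x in torus_measure. f x = g x)"

lemma L2_rel_refl_iff [simp]: "L2_rel f f \<longleftrightarrow> square_integrable f"
  by (simp add: L2_rel_def)

quotient_type 'n L2 = "'n::finite torus \<Rightarrow> complex" / partial: L2_rel
proof (rule part_equivpI)
  have "L2_rel (\<lambda>_. 0) (\<lambda>_. 0 :: complex)"
    by (simp add: square_integrable_def)
  then show "\<exists>f :: 'n torus \<Rightarrow> complex. L2_rel f f" by blast
  show "symp (L2_rel :: ('n torus \<Rightarrow> complex) \<Rightarrow> _)"
    unfolding symp_def L2_rel_def by (auto elim: eventually_mono)
  show "transp (L2_rel :: ('n torus \<Rightarrow> complex) \<Rightarrow> _)"
    unfolding transp_def L2_rel_def by (auto elim: eventually_elim2)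
qed

text \<open>The inner product is linear in its first argument and antilinear in the second.\<close>

lift_definition cinner :: "'n::finite L2 \<Rightarrow> 'n L2 \<Rightarrow> complex"
  is "\<lambda>\<psi> \<eta>. \<integral>x. \<psi> x * cnj (\<eta> x) \<partial>torus_measure"
proof -
  fix f f' g g' :: "'n torus \<Rightarrow> complex"
  assume "L2_rel f f'" "L2_rel g g'"
  then have [measurable]: "f \<in> borel_measurable torus_measure" "g \<in> borel_measurable torus_measure"
      "f' \<in> borel_measurable torus_measure" "g' \<in> borel_measurable torus_measure"
    and eq: "AE x in torus_measure. f x = f' x" "AE x in torus_measure. g x = g' x"
    by (auto simp: L2_rel_def square_integrable_def)
  from eq have "AE x in torus_measure. f x * cnj (g x) = f' x * cnj (g' x)"
    by eventually_elim simp
  then show "(\<integral>x. f x * cnj (g x) \<partial>torus_measure) = (\<integral>x. f' x * cnj (g' x) \<partial>torus_measure)"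
    by (intro integral_cong_AE) measurable
qed

lift_definition scaleC_L2 :: "complex \<Rightarrow> 'n::finite L2 \<Rightarrow> 'n L2" (infixr \<open>*\<^sub>C\<close> 75)
  is "\<lambda>c \<psi> x. c * \<psi> x"
  unfolding L2_rel_def by (auto intro: square_integrable_cmult elim: eventually_mono)

instantiation L2 :: (finite) real_inner
begin

lift_definition zero_L2 :: "'a L2" is "\<lambda>_. 0"
  by (simp add: square_integrable_def)

lift_definition plus_L2 :: "'a L2 \<Rightarrow> 'a L2 \<Rightarrow> 'a L2" is "\<lambda>\<psi> \<eta> x. \<psi> x + \<eta> x"
  unfolding L2_rel_def by (auto intro: square_integrable_add elim: eventually_elim2)

lift_definition minus_L2 :: "'a L2 \<Rightarrow> 'a L2 \<Rightarrow> 'a L2" is "\<lambda>\<psi> \<eta> x. \<psi> x - \<eta> x"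
  unfolding L2_rel_def by (auto intro: square_integrable_diff elim: eventually_elim2)

definition uminus_L2 :: "'a L2 \<Rightarrow> 'a L2"
  where "uminus_L2 \<psi> = (- 1) *\<^sub>C \<psi>"

definition scaleR_L2 :: "real \<Rightarrow> 'a L2 \<Rightarrow> 'a L2"
  where "scaleR_L2 r \<psi> = complex_of_real r *\<^sub>C \<psi>"

definition inner_L2 :: "'a L2 \<Rightarrow> 'a L2 \<Rightarrow> real"
  where "inner_L2 \<psi> \<eta> = Re (cinner \<psi> \<eta>)"

definition norm_L2 :: "'a L2 \<Rightarrow> real"
  where "norm_L2 \<psi> = sqrt (inner \<psi> \<psi>)"

definition dist_L2 :: "'a L2 \<Rightarrow> 'a L2 \<Rightarrow> real"
  where "dist_L2 \<psi> \<eta> = norm (\<psi> - \<eta>)"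

definition sgn_L2 :: "'a L2 \<Rightarrow> 'a L2"
  where "sgn_L2 \<psi> = inverse (norm \<psi>) *\<^sub>R \<psi>"

definition uniformity_L2 :: "('a L2 \<times> 'a L2) filter"
  where "uniformity_L2 = (INF e\<in>{0<..}. principal {(x, y). dist x y < e})"

definition open_L2 :: "'a L2 set \<Rightarrow> bool"
  where "open_L2 U \<longleftrightarrow> (\<forall>x\<in>U. eventually (\<lambda>(x', y). x' = x \<longrightarrow> y \<in> U) uniformity)"

instance
proof
  fix x y z :: "'a L2" and r s :: real
  show "x + y + z = x + (y + z)"
    by (transfer, auto simp: L2_rel_def add.assoc intro!: square_integrable_add)
  show "x + y = y + x"
    by (transfer, auto simp: L2_rel_def add.commute intro!: square_integrable_add)
  show "0 + x = x"
    by (transfer, auto simp: L2_rel_def)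
  show "- x + x = 0"
    unfolding uminus_L2_def
    by (transfer, auto simp: L2_rel_def square_integrable_def)
  show "x - y = x + - y"
    unfolding uminus_L2_def
    by (transfer, auto simp: L2_rel_def intro!: square_integrable_diff)
  show "r *\<^sub>R (x + y) = r *\<^sub>R x + r *\<^sub>R y"
    unfolding scaleR_L2_def
    by (transfer, auto simp: L2_rel_def distrib_left
        intro!: square_integrable_add square_integrable_cmult)
  show "(r + s) *\<^sub>R x = r *\<^sub>R x + s *\<^sub>R x"
    unfolding scaleR_L2_def
    by (transfer, auto simp: L2_rel_def distrib_right
        intro!: square_integrable_add square_integrable_cmult)
  show "r *\<^sub>R s *\<^sub>R x = (r * s) *\<^sub>R x"
    unfolding scaleR_L2_def
    by (transfer, auto simp: L2_rel_def mult.assoc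
        intro!: square_integrable_cmult)
  show "1 *\<^sub>R x = x"
    unfolding scaleR_L2_def by (transfer, auto simp: L2_rel_def)
  show "dist x y = norm (x - y)" by (rule dist_L2_def)
  show "sgn x = inverse (norm x) *\<^sub>R x" by (rule sgn_L2_def)
  show "(uniformity :: ('a L2 \<times> 'a L2) filter) = (INF e\<in>{0<..}. principal {(x, y). dist x y < e})"
    by (rule uniformity_L2_def)
  show "open U \<longleftrightarrow> (\<forall>x\<in>U. \<forall>\<^sub>F (x', y) in uniformity. x' = x \<longrightarrow> y \<in> U)" for U :: "'a L2 set"
    by (rule open_L2_def)
  show "inner x y = inner y x"
    unfolding inner_L2_def
  proof transfer
    fix f g :: "'a torus \<Rightarrow> complex"
    have "(\<integral>x. g x * cnj (f x) \<partial>torus_measure) = (\<integral>x. cnj (f x * cnj (g x)) \<partial>torus_measure)"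
      by (simp add: mult.commute)
    also have "\<dots> = cnj (\<integral>x. f x * cnj (g x) \<partial>torus_measure)"
      by (rule Bochner_Integration.integral_cnj)
    finally show "Re (\<integral>x. f x * cnj (g x) \<partial>torus_measure)
        = Re (\<integral>x. g x * cnj (f x) \<partial>torus_measure)" by simp
  qed
  show "inner (x + y) z = inner x z + inner y z"
    unfolding inner_L2_def
    by transfer (simp add: distrib_right integrable_mult_cnj)
  show "inner (r *\<^sub>R x) y = r * inner x y"
    unfolding inner_L2_def scaleR_L2_def
    by transfer (simp add: mult.assoc)
  have norm_sq: "Re (\<integral>x. f x * cnj (f x) \<partial>torus_measure) = (\<integral>x. (cmod (f x))\<^sup>2 \<partial>torus_measure)"
    for f :: "'a torus \<Rightarrow> complex"
    by (simp add: complex_norm_square[symmetric] del: of_real_power)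
  show "0 \<le> inner x x"
    unfolding inner_L2_def by transfer (simp add: norm_sq)
  show "inner x x = 0 \<longleftrightarrow> x = 0"
    unfolding inner_L2_def
  proof transfer
    fix f :: "'a torus \<Rightarrow> complex" assume "L2_rel f f"
    then have f: "square_integrable f" by simp
    have "(\<integral>x. (cmod (f x))\<^sup>2 \<partial>torus_measure) = 0 \<longleftrightarrow> (AE x in torus_measure. (cmod (f x))\<^sup>2 = 0)"
      using f by (intro integral_nonneg_eq_0_iff_AE) (auto simp: square_integrable_def)
    then show "Re (\<integral>x. f x * cnj (f x) \<partial>torus_measure) = 0 \<longleftrightarrow> L2_rel f (\<lambda>_. 0)"
      using f by (simp add: norm_sq L2_rel_def square_integrable_def)
  qed
  show "norm x = sqrt (inner x x)" by (rule norm_L2_def)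
qed

end

section \<open>Separability\<close>

text \<open>The Bochner integral is only available for second countable spaces; it is needed below to
  integrate the identity of the sphere against a probability measure.\<close>

lemma L2_cases:
  obtains f where "square_integrable f" "\<psi> = abs_L2 f"
proof -
  have "\<exists>f. square_integrable f \<and> \<psi> = abs_L2 f"
    by (induction \<psi> rule: L2.abs_induct) auto
  then show ?thesis using that by blast
qed

lemma norm_abs_L2_power2:
  assumes "square_integrable f"
  shows "(norm (abs_L2 f))\<^sup>2 = (\<integral>x. (cmod (f x))\<^sup>2 \<partial>torus_measure)"
proof -
  have "(norm (abs_L2 f))\<^sup>2 = inner (abs_L2 f) (abs_L2 f)"
    by (simp add: power2_norm_eq_inner)
  also have "\<dots> = Re (\<integral>x. f x * cnj (f x) \<partial>torus_measure)"
    using assms by (simp add: inner_L2_def cinner.abs_eq)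
  also have "\<dots> = (\<integral>x. (cmod (f x))\<^sup>2 \<partial>torus_measure)"
    by (simp add: complex_norm_square[symmetric] del: of_real_power)
  finally show ?thesis .
qed

lemma abs_L2_add:
  "square_integrable f \<Longrightarrow> square_integrable g \<Longrightarrow> abs_L2 f + abs_L2 g = abs_L2 (\<lambda>x. f x + g x)"
  by (simp add: plus_L2.abs_eq)

lemma abs_L2_diff:
  "square_integrable f \<Longrightarrow> square_integrable g \<Longrightarrow> abs_L2 f - abs_L2 g = abs_L2 (\<lambda>x. f x - g x)"
  by (simp add: minus_L2.abs_eq)

lemma abs_L2_scaleC:
  "square_integrable f \<Longrightarrow> c *\<^sub>C abs_L2 f = abs_L2 (\<lambda>x. c * f x)"
  by (simp add: scaleC_L2.abs_eq)

lemma norm_scaleC_L2: "norm (c *\<^sub>C \<psi>) = cmod c * norm (\<psi> :: 'n::finite L2)"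
proof -
  obtain f where f: "square_integrable f" "\<psi> = abs_L2 f" by (rule L2_cases)
  have "(norm (c *\<^sub>C \<psi>))\<^sup>2 = (cmod c * norm \<psi>)\<^sup>2"
    using f by (simp add: abs_L2_scaleC norm_abs_L2_power2 square_integrable_cmult norm_mult
        power_mult_distrib)
  then show ?thesis by (simp add: power2_eq_iff_nonneg)
qed

lemma abs_L2_tendsto:
  fixes f :: "'n::finite torus \<Rightarrow> complex"
  assumes s: "\<And>i. s i \<in> borel_measurable torus_measure" and f: "square_integrable f"
    and lim: "\<And>x. (\<lambda>i. s i x) \<longlonglongrightarrow> f x" and bd: "\<And>i x. cmod (s i x) \<le> 2 * cmod (f x)"
  shows "(\<lambda>i. abs_L2 (s i)) \<longlonglongrightarrow> abs_L2 f"
proof -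
  note [measurable] = s
  have f' [measurable]: "f \<in> borel_measurable torus_measure"
    and fi: "integrable torus_measure (\<lambda>x. (cmod (f x))\<^sup>2)"
    using f by (auto simp: square_integrable_def)
  have si: "square_integrable (s i)" for i
  proof -
    have "integrable torus_measure (\<lambda>x. (cmod (s i x))\<^sup>2)"
    proof (rule Bochner_Integration.integrable_bound)
      show "integrable torus_measure (\<lambda>x. 4 * (cmod (f x))\<^sup>2)" using fi by simp
      have "(cmod (s i x))\<^sup>2 \<le> 4 * (cmod (f x))\<^sup>2" for x
        using power_mono[OF bd[of i x], of 2] by (simp add: power_mult_distrib)
      then show "AE x in torus_measure. norm ((cmod (s i x))\<^sup>2) \<le> norm (4 * (cmod (f x))\<^sup>2)"
        by auto
    qed measurable
    then show ?thesis by (simp add: square_integrable_def s)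
  qed
  have "(\<lambda>i. \<integral>x. (cmod (s i x - f x))\<^sup>2 \<partial>torus_measure) \<longlonglongrightarrow> (\<integral>x. 0 \<partial>(torus_measure :: 'n torus measure))"
  proof (rule Bochner_Integration.integral_dominated_convergence[where w = "\<lambda>x. 9 * (cmod (f x))\<^sup>2"])
    show "integrable torus_measure (\<lambda>x. 9 * (cmod (f x))\<^sup>2)" using fi by simp
    have "(\<lambda>i. (cmod (s i x - f x))\<^sup>2) \<longlonglongrightarrow> (cmod (f x - f x))\<^sup>2" for x
      by (intro tendsto_intros lim)
    then show "AE x in torus_measure. (\<lambda>i. (cmod (s i x - f x))\<^sup>2) \<longlonglongrightarrow> 0" by simp
    have "(cmod (s i x - f x))\<^sup>2 \<le> 9 * (cmod (f x))\<^sup>2" for i x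
    proof -
      have "cmod (s i x - f x) \<le> 3 * cmod (f x)"
        using norm_triangle_ineq4[of "s i x" "f x"] bd[of i x] by linarith
      from power_mono[OF this, of 2] show ?thesis by (simp add: power_mult_distrib)
    qed
    then show "AE x in torus_measure. norm ((cmod (s i x - f x))\<^sup>2) \<le> 9 * (cmod (f x))\<^sup>2" for i
      by simp
  qed measurable
  then have "(\<lambda>i. (norm (abs_L2 (s i) - abs_L2 f))\<^sup>2) \<longlonglongrightarrow> 0"
    by (simp add: abs_L2_diff si f norm_abs_L2_power2 square_integrable_diff)
  from tendsto_real_sqrt[OF this] have "(\<lambda>i. norm (abs_L2 (s i) - abs_L2 f)) \<longlonglongrightarrow> 0" by simp
  then show ?thesis
    using Lim_null tendsto_norm_zero_iff by blast
qed

lemma square_integrable_indicator: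
  "A \<in> sets borel \<Longrightarrow> square_integrable (indicator A :: 'n::finite torus \<Rightarrow> complex)"
  by (rule square_integrable_bounded[where B = 1]) (auto simp: indicator_def)

lemma countable_dense_L2: "\<exists>D :: 'n::finite L2 set. countable D \<and> closure D = UNIV"
proof -
  obtain B0 :: "'n torus set set" where B0: "countable B0" "topological_basis B0"
    using ex_countable_basis by blast
  define B where "B = (\<lambda>F. \<Inter>F) ` {F. finite F \<and> F \<subseteq> B0}"
  have B0_open: "open b" if "b \<in> B0" for b
    using that topological_basis_open[OF B0(2)] by blast
  have B_open: "open b" if "b \<in> B" for b
    using that B0_open unfolding B_def by (auto intro!: open_Inter)
  have B_cnt: "countable B"
    unfolding B_def using B0(1) by (intro countable_image countable_Collect_finite_subset)
  have B_univ: "UNIV \<in> B"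
    unfolding B_def by (rule image_eqI[of _ _ "{}"]) auto
  have B_Int: "Int_stable B"
  proof (rule Int_stableI)
    fix a b assume "a \<in> B" "b \<in> B"
    then obtain F G where "finite F" "F \<subseteq> B0" "a = \<Inter>F" "finite G" "G \<subseteq> B0" "b = \<Inter>G"
      unfolding B_def by blast
    then have "a \<inter> b = \<Inter>(F \<union> G)" "finite (F \<union> G)" "F \<union> G \<subseteq> B0" by auto
    then show "a \<inter> b \<in> B" unfolding B_def by blast
  qed
  have B0_sub: "B0 \<subseteq> B"
  proof
    fix b assume "b \<in> B0"
    then show "b \<in> B" unfolding B_def by (intro image_eqI[of _ _ "{b}"]) auto
  qed
  have B_basis: "topological_basis B"
    using B0(2) B0_sub B_open unfolding topological_basis_def by (meson order_trans)
  have borel_B: "sets (borel :: 'n torus measure) = sigma_sets UNIV B"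
    by (subst borel_eq_countable_basis[OF B_cnt B_basis]) (simp add: sets_measure_of)

  define T :: "complex set" where "T = (\<lambda>(p, q). Complex (of_rat p) (of_rat q)) ` UNIV"
  define D where "D = (\<lambda>l. \<Sum>(c, b)\<leftarrow>l. c *\<^sub>C abs_L2 (indicator b :: 'n torus \<Rightarrow> complex)) ` lists (T \<times> B)"
  have T_cnt: "countable T" unfolding T_def by simp
  have D_cnt: "countable D"
    unfolding D_def using T_cnt B_cnt by (intro countable_image countable_lists countable_SIGMA) auto
  let ?C = "closure D"

  have D_add: "x + y \<in> D" if "x \<in> D" "y \<in> D" for x y
  proof -
    from that obtain l m where "l \<in> lists (T \<times> B)" "m \<in> lists (T \<times> B)"
      "x = (\<Sum>(c, b)\<leftarrow>l. c *\<^sub>C abs_L2 (indicator b))" "y = (\<Sum>(c, b)\<leftarrow>m. c *\<^sub>C abs_L2 (indicator b))"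
      unfolding D_def by blast
    then show ?thesis unfolding D_def by (intro image_eqI[of _ _ "l @ m"]) auto
  qed
  have C_add: "x + y \<in> ?C" if xy: "x \<in> ?C" "y \<in> ?C" for x y
  proof -
    from xy obtain a b where "\<And>n. a n \<in> D" "a \<longlonglongrightarrow> x" "\<And>n. b n \<in> D" "b \<longlonglongrightarrow> y"
      unfolding closure_sequential by blast
    then have "\<And>n. a n + b n \<in> D" "(\<lambda>n. a n + b n) \<longlonglongrightarrow> x + y"
      by (auto intro: D_add tendsto_add)
    then show ?thesis unfolding closure_sequential by (intro exI[of _ "\<lambda>n. a n + b n"]) auto
  qed
  have zero_D: "0 \<in> D"
    unfolding D_def by (intro image_eqI[of _ _ "[]"]) auto
  have C_zero: "0 \<in> ?C" using zero_D closure_subset by blast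

  have scaleC_add: "c *\<^sub>C (x + y) = c *\<^sub>C x + c *\<^sub>C y" for c and x y :: "'n L2"
    by (transfer, auto simp: L2_rel_def distrib_left
        intro!: square_integrable_add square_integrable_cmult)
  have scaleC_diff: "c *\<^sub>C (x - y) = c *\<^sub>C x - c *\<^sub>C y" for c and x y :: "'n L2"
    by (transfer, auto simp: L2_rel_def right_diff_distrib
        intro!: square_integrable_diff square_integrable_cmult)
  have scaleC_diff_left: "(c - d) *\<^sub>C x = c *\<^sub>C x - d *\<^sub>C x" for c d and x :: "'n L2"
    by (transfer, auto simp: L2_rel_def left_diff_distrib
        intro!: square_integrable_diff square_integrable_cmult)
  have scaleC_assoc: "c *\<^sub>C d *\<^sub>C x = (c * d) *\<^sub>C x" for c d and x :: "'n L2"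
    by (transfer, auto simp: L2_rel_def mult.assoc intro!: square_integrable_cmult)
  have scaleC_zero: "c *\<^sub>C (0 :: 'n L2) = 0" for c
    using norm_scaleC_L2[of c "0 :: 'n L2"] by simp

  have T_mult: "c * d \<in> T" if "c \<in> T" "d \<in> T" for c d
  proof -
    from that obtain p q p' q' where "c = Complex (of_rat p) (of_rat q)" "d = Complex (of_rat p') (of_rat q')"
      unfolding T_def by auto
    then have "c * d = Complex (of_rat (p * p' - q * q')) (of_rat (p * q' + q * p'))"
      by (simp add: complex_eq_iff of_rat_mult of_rat_diff of_rat_add)
    then show ?thesis unfolding T_def by auto
  qed
  have D_scale: "t *\<^sub>C x \<in> D" if t: "t \<in> T" and "x \<in> D" for t x
  proof -
    from that obtain l where l: "l \<in> lists (T \<times> B)"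
      "x = (\<Sum>(c, b)\<leftarrow>l. c *\<^sub>C abs_L2 (indicator b))"
      unfolding D_def by blast
    have "t *\<^sub>C (\<Sum>(c, b)\<leftarrow>l. c *\<^sub>C abs_L2 (indicator b))
        = (\<Sum>(c, b)\<leftarrow>map (\<lambda>(c, b). (t * c, b)) l. c *\<^sub>C abs_L2 (indicator b))" for l :: "(complex \<times> 'n torus set) list"
      by (induction l) (auto simp: scaleC_zero scaleC_add scaleC_assoc)
    moreover have "map (\<lambda>(c, b). (t * c, b)) l \<in> lists (T \<times> B)"
      using l(1) t T_mult by (auto simp: lists_eq_set)
    ultimately show ?thesis
      unfolding D_def using l(2) by blast
  qed
  have T_dense: "\<exists>t\<in>T. cmod (t - c) < e" if "e > 0" for c e
  proof -
    obtain p where p: "Re c < of_rat p" "of_rat p < Re c + e / 2"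
      using of_rat_dense[of "Re c" "Re c + e / 2"] \<open>e > 0\<close> by auto
    obtain q where q: "Im c < of_rat q" "of_rat q < Im c + e / 2"
      using of_rat_dense[of "Im c" "Im c + e / 2"] \<open>e > 0\<close> by auto
    let ?t = "Complex (of_rat p) (of_rat q)"
    have "cmod (?t - c) \<le> \<bar>Re (?t - c)\<bar> + \<bar>Im (?t - c)\<bar>" by (rule cmod_le)
    also have "\<dots> < e" using p q by simp
    finally show ?thesis unfolding T_def by auto
  qed
  have C_scale_T: "t *\<^sub>C x \<in> ?C" if t: "t \<in> T" and x: "x \<in> ?C" for t x
  proof -
    from x obtain a where a: "\<And>n. a n \<in> D" "a \<longlonglongrightarrow> x"
      unfolding closure_sequential by blast
    have "(\<lambda>n. cmod t * norm (a n - x)) \<longlonglongrightarrow> cmod t * norm (x - x)"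
      by (intro tendsto_intros a)
    then have "(\<lambda>n. norm (t *\<^sub>C a n - t *\<^sub>C x)) \<longlonglongrightarrow> 0"
      by (simp add: scaleC_diff[symmetric] norm_scaleC_L2)
    then have "(\<lambda>n. t *\<^sub>C a n) \<longlonglongrightarrow> t *\<^sub>C x"
      using Lim_null tendsto_norm_zero_iff by blast
    then show ?thesis
      unfolding closure_sequential using a(1) t D_scale by (intro exI[of _ "\<lambda>n. t *\<^sub>C a n"]) auto
  qed
  have C_scale: "c *\<^sub>C x \<in> ?C" if x: "x \<in> ?C" for c x
  proof -
    have "c *\<^sub>C x \<in> closure ?C"
      unfolding closure_approachable
    proof (intro allI impI)
      fix e :: real assume "e > 0"
      then have "e / (norm x + 1) > 0" by (simp add: add_nonneg_pos)
      then obtain t where t: "t \<in> T" "cmod (t - c) < e / (norm x + 1)"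
        using T_dense by blast
      have "dist (t *\<^sub>C x) (c *\<^sub>C x) = cmod (t - c) * norm x"
        by (simp add: dist_norm scaleC_diff_left[symmetric] norm_scaleC_L2)
      also have "\<dots> \<le> cmod (t - c) * (norm x + 1)" by (simp add: mult_left_mono)
      also have "\<dots> < e" using t(2) by (simp add: pos_less_divide_eq add_nonneg_pos)
      finally show "\<exists>y\<in>?C. dist y (c *\<^sub>C x) < e"
        using C_scale_T[OF t(1) x] by blast
    qed
    then show ?thesis by simp
  qed
  have C_diff: "x - y \<in> ?C" if "x \<in> ?C" "y \<in> ?C" for x y
  proof -
    have "x - y = x + (- 1) *\<^sub>C y"
      by (simp add: uminus_L2_def[symmetric])
    then show ?thesis using C_add[OF that(1) C_scale[OF that(2)]] by metis
  qed
  have scaleC_one: "1 *\<^sub>C x = x" for x :: "'n L2"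
    by (transfer, auto simp: L2_rel_def)

  have C_lim: "l \<in> ?C" if "\<And>n. a n \<in> ?C" "a \<longlonglongrightarrow> l" for a l
    using closed_sequentially[OF closed_closure, of a D l] that by blast
  have ind_empty: "abs_L2 (indicator {}) = (0 :: 'n L2)"
  proof -
    have "(indicator {} :: 'n torus \<Rightarrow> complex) = (\<lambda>_. 0)" by auto
    then show ?thesis by (metis zero_L2_def)
  qed
  have Pow_UNIV_sub: "B \<subseteq> Pow UNIV" by simp
  have borel_UNIV: "(UNIV :: 'n torus set) \<in> sets borel" by simp
  have ind: "abs_L2 (indicator A) \<in> ?C" if "A \<in> sets borel" for A :: "'n torus set"
  proof -
    have "A \<in> sigma_sets UNIV B" using that borel_B by simp
    with B_Int Pow_UNIV_sub show ?thesis
    proof (rule sigma_sets_induct_disjoint[where P = "\<lambda>A. abs_L2 (indicator A) \<in> ?C"])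
      fix A assume A: "A \<in> B"
      have "1 *\<^sub>C abs_L2 (indicator A) \<in> D"
        unfolding D_def
        by (rule image_eqI[of _ _ "[(1, A)]"])
          (use A in \<open>auto simp: T_def intro!: image_eqI[of _ _ "(1, 0)"] simp: complex_eq_iff\<close>)
      then show "abs_L2 (indicator A) \<in> ?C"
        using closure_subset by (auto simp: scaleC_one)
    next
      show "abs_L2 (indicator {}) \<in> ?C"
        using C_zero ind_empty by metis
    next
      fix A assume A: "A \<in> sigma_sets UNIV B" "abs_L2 (indicator A) \<in> ?C"
      have Ab: "A \<in> sets borel" using A(1) borel_B by simp
      have "1 *\<^sub>C abs_L2 (indicator UNIV) \<in> D"
        unfolding D_def
        by (rule image_eqI[of _ _ "[(1, UNIV)]"])
          (use B_univ in \<open>auto simp: T_def intro!: image_eqI[of _ _ "(1, 0)"] simp: complex_eq_iff\<close>)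
      then have "abs_L2 (indicator UNIV) \<in> ?C"
        using closure_subset by (auto simp: scaleC_one)
      from C_diff[OF this A(2)] have "abs_L2 (\<lambda>x. indicator UNIV x - indicator A x) \<in> ?C"
        unfolding abs_L2_diff[OF square_integrable_indicator[OF borel_UNIV] square_integrable_indicator[OF Ab]] .
      moreover have "(\<lambda>x. indicator UNIV x - indicator A x) = (indicator (UNIV - A) :: _ \<Rightarrow> complex)"
        by (auto simp: indicator_def)
      ultimately show "abs_L2 (indicator (UNIV - A)) \<in> ?C" by simp
    next
      fix A :: "nat \<Rightarrow> 'n torus set"
      assume disj: "disjoint_family A" and A: "range A \<subseteq> sigma_sets UNIV B"
        and C: "\<And>i. abs_L2 (indicator (A i)) \<in> ?C"
      have Am [measurable]: "A i \<in> sets borel" for i using A borel_B by auto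
      define S where "S n = (\<Union>i<n. A i)" for n
      have Sm [measurable]: "S n \<in> sets borel" for n unfolding S_def by auto
      have SC: "abs_L2 (indicator (S n)) \<in> ?C" for n
      proof (induction n)
        case 0
        have "S 0 = {}" by (simp add: S_def)
        then have "abs_L2 (indicator (S 0)) = (0 :: 'n L2)" by (simp only: ind_empty)
        then show ?case using C_zero by (simp only:)
      next
        case (Suc n)
        have "A i \<inter> A n = {}" if "i < n" for i
          using disjoint_family_onD[OF disj, of i n] that by simp
        then have "S n \<inter> A n = {}" by (auto simp: S_def)
        then have "indicator (S (Suc n)) = (\<lambda>x. indicator (S n) x + indicator (A n) x :: complex)"
          by (auto simp: S_def lessThan_Suc indicator_def fun_eq_iff)
        then show ?case
          using C_add[OF Suc C[of n]]
          by (simp add: abs_L2_add square_integrable_indicator)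
      qed
      have "(\<lambda>n. abs_L2 (indicator (S n))) \<longlonglongrightarrow> abs_L2 (indicator (\<Union>i. A i))"
      proof (rule abs_L2_tendsto)
        show "square_integrable (indicator (\<Union>i. A i))"
          by (rule square_integrable_indicator) auto
        show "(\<lambda>n. indicator (S n) x) \<longlonglongrightarrow> (indicator (\<Union>i. A i) x :: complex)" for x
          unfolding S_def by (rule LIMSEQ_indicator_UN)
        show "cmod (indicator (S i) x) \<le> 2 * cmod (indicator (\<Union>i. A i) x)" for i x
          by (auto simp: S_def indicator_def)
      qed measurable
      then show "abs_L2 (indicator (\<Union>i. A i)) \<in> ?C"
        by (rule C_lim[OF SC])
    qed
  qed

  have "x \<in> ?C" for x
  proof -
    obtain f where f: "square_integrable f" "x = abs_L2 f" by (rule L2_cases)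
    then have fm: "f \<in> borel_measurable torus_measure" by (simp add: square_integrable_def)
    obtain s where s: "\<And>i. simple_function torus_measure (s i)"
      "\<And>x. x \<in> space torus_measure \<Longrightarrow> (\<lambda>i. s i x) \<longlonglongrightarrow> f x"
      "\<And>i x. x \<in> space torus_measure \<Longrightarrow> dist (s i x) 0 \<le> 2 * dist (f x) 0"
      using borel_measurable_implies_sequence_metric[OF fm, of 0] by blast
    have "abs_L2 (s i) \<in> ?C" for i
    proof -
      let ?R = "s i ` UNIV"
      have fin: "finite ?R" using s(1)[of i] by (simp add: simple_function_def)
      have ms: "s i -` {y} \<in> sets borel" if "y \<in> ?R" for y
        using s(1)[of i] that by (auto simp: simple_function_def)
      have "square_integrable (\<lambda>x. \<Sum>y\<in>F. y * indicator (s i -` {y}) x) \<and>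
            abs_L2 (\<lambda>x. \<Sum>y\<in>F. y * indicator (s i -` {y}) x) \<in> ?C" if "finite F" "F \<subseteq> ?R" for F
        using that
      proof (induction F)
        case empty
        then show ?case
          using C_zero by (simp add: square_integrable_def zero_L2_def map_fun_def)
      next
        case (insert y F)
        have yi: "square_integrable (indicator (s i -` {y}) :: _ \<Rightarrow> complex)"
          using insert.prems ms by (intro square_integrable_indicator) auto
        have "y *\<^sub>C abs_L2 (indicator (s i -` {y})) \<in> ?C"
          using insert.prems ms by (intro C_scale ind) auto
        then have 1: "abs_L2 (\<lambda>x. y * indicator (s i -` {y}) x) \<in> ?C"
          by (simp add: abs_L2_scaleC yi)
        have 2: "square_integrable (\<lambda>x. y * indicator (s i -` {y}) x)"
          by (rule square_integrable_cmult[OF yi])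
        from insert have IH: "square_integrable (\<lambda>x. \<Sum>y\<in>F. y * indicator (s i -` {y}) x)"
            "abs_L2 (\<lambda>x. \<Sum>y\<in>F. y * indicator (s i -` {y}) x) \<in> ?C" by auto
        show ?case
          using square_integrable_add[OF 2 IH(1)] C_add[OF 1 IH(2)]
          by (simp only: abs_L2_add[OF 2 IH(1)] sum.insert[OF insert.hyps] simp_thms)
      qed
      from this[OF fin order_refl]
      have "abs_L2 (\<lambda>x. \<Sum>y\<in>?R. y * indicator (s i -` {y}) x) \<in> ?C" by blast
      moreover have "(\<Sum>y\<in>?R. y * indicator (s i -` {y}) x) = s i x" for x
      proof -
        have "(\<Sum>y\<in>?R. y * indicator (s i -` {y}) x) = (\<Sum>y\<in>?R. if y = s i x then y else 0)"
          by (rule sum.cong) (auto simp: indicator_def)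
        also have "\<dots> = s i x" using fin by (subst sum.delta) auto
        finally show ?thesis .
      qed
      ultimately show ?thesis by simp
    qed
    then have "abs_L2 f \<in> ?C"
    proof (rule C_lim)
      show "(\<lambda>i. abs_L2 (s i)) \<longlonglongrightarrow> abs_L2 f"
      proof (rule abs_L2_tendsto[OF _ f(1)])
        show "s i \<in> borel_measurable torus_measure" for i
          by (rule borel_measurable_simple_function[OF s(1)])
        show "(\<lambda>i. s i x) \<longlonglongrightarrow> f x" for x
          using s(2) by simp
        show "cmod (s i x) \<le> 2 * cmod (f x)" for i x
          using s(3)[of x i] by simp
      qed
    qed
    then show ?thesis by (simp only: f(2))
  qed
  then show ?thesis using D_cnt by blast
qed

instance L2 :: (finite) second_countable_topology
proof
  obtain D :: "'a L2 set" where D: "countable D" "closure D = UNIV"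
    using countable_dense_L2 by blast
  let ?B = "(\<lambda>(d, n). ball d (1 / Suc n)) ` (D \<times> (UNIV :: nat set))"
  have "topological_basis ?B"
  proof (rule topological_basisI)
    show "open b" if "b \<in> ?B" for b using that by auto
  next
    fix U :: "'a L2 set" and x assume U: "open U" "x \<in> U"
    then obtain e where e: "e > 0" "ball x e \<subseteq> U" using open_contains_ball by blast
    obtain n where n: "1 / Suc n < e / 2" using nat_approx_posE[of "e / 2"] e(1) by auto
    have "x \<in> closure D" using D(2) by simp
    then obtain d where d: "d \<in> D" "dist d x < 1 / Suc n"
      unfolding closure_approachable by (metis divide_pos_pos of_nat_0_less_iff zero_less_Suc zero_less_one)
    have "ball d (1 / Suc n) \<subseteq> ball x e"
    proof
      fix y assume "y \<in> ball d (1 / Suc n)"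
      then have "dist x y < e"
        using dist_triangle[of x y d] d(2) n by (simp add: dist_commute)
      then show "y \<in> ball x e" by simp
    qed
    moreover have "x \<in> ball d (1 / Suc n)" using d(2) by simp
    moreover have "ball d (1 / Suc n) \<in> ?B" using d(1) by (intro image_eqI[of _ _ "(d, n)"]) auto
    ultimately show "\<exists>b\<in>?B. x \<in> b \<and> b \<subseteq> U"
      using e(2) by (meson order_trans)
  qed
  moreover have "countable ?B" using D(1) by (intro countable_image countable_SIGMA) auto
  ultimately show "\<exists>B :: 'a L2 set set. countable B \<and> open = generate_topology B"
    using topological_basis_imp_subbasis by blast
qed

section \<open>Lagrangian weak solutions\<close>

abbreviation borel_sphere :: "'n::finite L2 measure"
  where "borel_sphere \<equiv> restrict_space borel (sphere 0 1)"

definition supp :: "'n::finite L2 measure \<Rightarrow> 'n L2 set" where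
  "supp \<mu> = {\<phi> \<in> space \<mu>. \<forall>U. open U \<and> \<phi> \<in> U \<longrightarrow> emeasure \<mu> (U \<inter> space \<mu>) > 0}"

definition supp_diameter :: "'n::finite L2 measure \<Rightarrow> real" where
  "supp_diameter \<mu> = diameter (supp \<mu>)"

text \<open>Continuity in time for the topology of weak (narrow) convergence of probability measures
  on the sphere.\<close>

definition narrowly_continuous :: "(real \<Rightarrow> 'n::finite L2 measure) \<Rightarrow> bool" where
  "narrowly_continuous \<rho> \<longleftrightarrow>
     (\<forall>f :: 'n L2 \<Rightarrow> real. continuous_on (sphere 0 1) f \<and> bounded (f ` sphere 0 1)
        \<longrightarrow> continuous_on {0..} (\<lambda>t. \<integral>\<phi>. f \<phi> \<partial>\<rho> t))"

definition velocity :: "real \<Rightarrow> 'n::finite L2 measure \<Rightarrow> 'n L2 \<Rightarrow> 'n L2" where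
  "velocity \<kappa> \<mu> \<phi> = (\<kappa> / 2) *\<^sub>R (\<integral>\<phi>'. \<phi>' - cinner \<phi> \<phi>' *\<^sub>C \<phi> \<partial>\<mu>)"

definition characteristic_flow ::
    "real \<Rightarrow> (real \<Rightarrow> 'n::finite L2 measure) \<Rightarrow> (real \<Rightarrow> 'n L2 \<Rightarrow> 'n L2) \<Rightarrow> bool" where
  "characteristic_flow \<kappa> \<rho> S \<longleftrightarrow>
     (\<forall>\<phi>0\<in>sphere 0 1. S 0 \<phi>0 = \<phi>0 \<and>
        (\<forall>t\<ge>0. S t \<phi>0 \<in> sphere 0 1 \<and>
           ((\<lambda>s. S s \<phi>0) has_vector_derivative velocity \<kappa> (\<rho> t) (S t \<phi>0)) (at t within {0..})))"

text \<open>Measurability of the flow maps is what makes the push-forward meaningful: in this library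
  \<^const>\<open>distr\<close> is only the push-forward along measurable maps.\<close>

definition lagrangian_weak_solution ::
    "real \<Rightarrow> 'n::finite L2 measure \<Rightarrow> (real \<Rightarrow> 'n L2 measure) \<Rightarrow> bool" where
  "lagrangian_weak_solution \<kappa> \<rho>0 \<rho> \<longleftrightarrow>
     (\<forall>t\<ge>0. \<rho> t \<in> space (prob_algebra borel_sphere)) \<and> narrowly_continuous \<rho> \<and>
     (\<exists>S. characteristic_flow \<kappa> \<rho> S \<and>
        (\<forall>t\<ge>0. S t \<in> borel_sphere \<rightarrow>\<^sub>M borel_sphere \<and> \<rho> t = distr \<rho>0 borel_sphere (S t)))"

end

theory Submission
  imports Defs
begin

text \<open>
  Two characteristics \<open>\<phi>\<close>, \<open>\<psi>\<close> issued from the support \<open>E\<close> of the initial measure are attracted by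
  each \<open>\<eta>\<close> in the moving set \<open>S t ` E\<close>, of diameter \<open>m t\<close>. The real part of the coupling contracts
  \<open>norm (\<phi> - \<psi>)\<close> at rate at least \<open>\<kappa> / 2 * (1 - m)\<close>, and the phase terms, being products of two
  quantities of size \<open>norm (\<phi> - \<psi>)\<close> and one of size \<open>m\<close>, cost at most another \<open>\<kappa> / 2 * m\<close>. Gronwall's inequality for
  each pair, followed by the supremum over pairs, gives an integral inequality for \<open>m\<close>, which is
  compared with the logistic equation \<open>y' = - (\<kappa> / 2) y (1 - 2 y)\<close>. Working with \<open>m\<close>, which is Lipschitz
  in time, rather than with the diameter of the support of \<open>\<rho> t\<close>, makes it unnecessary to know that
  the flow depends continuously on the initial datum: it suffices that the support of \<open>\<rho> t\<close> lies in the closure of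
  \<open>S t ` E\<close>.
\<close>

section \<open>Completeness of the space of square integrable functions\<close>

text \<open>Cauchy--Schwarz against the constant 1. Taking the modulus first makes the pairing real,
  so \<open>inner\<close>, which is only a real part, loses nothing. Cauchy sequences in L2 thus
  become Cauchy in L1, where an almost everywhere Cauchy subsequence can be extracted.\<close>

lemma integral_norm_le_norm_L2:
  fixes g :: "'n::finite torus \<Rightarrow> complex"
  assumes g: "square_integrable g"
  shows "(\<integral>x. cmod (g x) \<partial>torus_measure) \<le> norm (abs_L2 g) * norm (abs_L2 (\<lambda>_. 1) :: 'n L2)"
proof -
  have [measurable]: "g \<in> borel_measurable torus_measure"
    using g by (simp add: square_integrable_def)
  have abs: "square_integrable (\<lambda>x. complex_of_real (cmod (g x)))"
    using g by (simp add: square_integrable_def)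
  have one: "square_integrable (\<lambda>_ :: 'n torus. 1)"
    by (rule square_integrable_bounded[where B = 1]) auto
  have "(\<integral>x. cmod (g x) \<partial>torus_measure)
      = inner (abs_L2 (\<lambda>x. complex_of_real (cmod (g x)))) (abs_L2 (\<lambda>_. 1))"
    using abs one by (simp add: inner_L2_def cinner.abs_eq)
  also have "\<dots> \<le> norm (abs_L2 (\<lambda>x. complex_of_real (cmod (g x)))) * norm (abs_L2 (\<lambda>_. 1) :: 'n L2)"
    by (rule norm_cauchy_schwarz)
  also have "norm (abs_L2 (\<lambda>x. complex_of_real (cmod (g x)))) = norm (abs_L2 g)"
    by (rule power2_eq_imp_eq) (simp_all add: norm_abs_L2_power2 g abs)
  finally show ?thesis .
qed

text \<open>Norms in the form to which Fatou's lemma applies, before the limit is known to be square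
  integrable.\<close>

lemma nn_integral_norm_abs_L2:
  assumes "square_integrable f"
  shows "(\<integral>\<^sup>+x. ennreal ((cmod (f x))\<^sup>2) \<partial>torus_measure) = ennreal ((norm (abs_L2 f))\<^sup>2)"
  using assms by (simp add: norm_abs_L2_power2 square_integrable_def nn_integral_eq_integral)

text \<open>Riesz--Fischer. Without completeness the Bochner integral defining \<^const>\<open>velocity\<close>
  might fail to exist, in which case it would take the junk value \<open>0\<close>.\<close>

instance L2 :: (finite) banach
proof
  fix X :: "nat \<Rightarrow> 'a L2"
  assume X: "Cauchy X"
  have "\<forall>n. \<exists>f. square_integrable f \<and> X n = abs_L2 f"
    by (meson L2_cases)
  then obtain f where f: "\<And>n. square_integrable (f n)" and Xf: "\<And>n. X n = abs_L2 (f n)"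
    by metis
  have fm [measurable]: "f n \<in> borel_measurable torus_measure" for n
    using f by (simp add: square_integrable_def)
  interpret finite_measure "torus_measure :: 'a torus measure"
    by (rule finite_measure_torus)
  have one: "square_integrable (\<lambda>_ :: 'a torus. 1)"
    by (rule square_integrable_bounded[where B = 1]) auto
  have fi: "integrable torus_measure (f n)" for n
    using integrable_mult_cnj[OF f one] by simp
  have dX: "X i - X j = abs_L2 (\<lambda>x. f i x - f j x)" for i j
    by (simp add: Xf abs_L2_diff f)
  define M where "M = norm (abs_L2 (\<lambda>_. 1) :: 'a L2)"
  have L1: "\<exists>N. \<forall>i\<ge>N. \<forall>j\<ge>N. (\<integral>x. norm (f i x - f j x) \<partial>torus_measure) < e" if "e > 0" for e
  proof -
    have "0 < e / (M + 1)" using that by (simp add: M_def add_nonneg_pos)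
    then obtain N where N: "\<And>i j. i \<ge> N \<Longrightarrow> j \<ge> N \<Longrightarrow> norm (X i - X j) < e / (M + 1)"
      using X unfolding Cauchy_iff by meson
    have "(\<integral>x. norm (f i x - f j x) \<partial>torus_measure) < e" if "i \<ge> N" "j \<ge> N" for i j
    proof -
      have "(\<integral>x. norm (f i x - f j x) \<partial>torus_measure) \<le> norm (X i - X j) * M"
        unfolding dX M_def by (intro integral_norm_le_norm_L2 square_integrable_diff f)
      also have "\<dots> \<le> norm (X i - X j) * (M + 1)" by (simp add: mult_left_mono)
      also have "\<dots> < e"
        using N[OF that] by (simp add: pos_less_divide_eq M_def add_nonneg_pos)
      finally show ?thesis .
    qed
    then show ?thesis by blast
  qed
  obtain r where r: "strict_mono r"
    and AEC: "AE x in torus_measure. Cauchy (\<lambda>i. f (r i) x)"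
    using cauchy_L1_AE_cauchy_subseq[OF fi L1] by metis
  \<comment> \<open>On the null set where the subsequence diverges, \<open>lim\<close> is an
    unspecified value; this keeps \<open>g\<close> measurable and does not affect its class.\<close>
  define g where "g x = lim (\<lambda>i. f (r i) x)" for x
  have gm [measurable]: "g \<in> borel_measurable torus_measure"
    unfolding g_def by measurable
  have lim: "AE x in torus_measure. (\<lambda>i. f (r i) x) \<longlonglongrightarrow> g x"
    using AEC by eventually_elim (simp add: g_def Cauchy_convergent convergent_LIMSEQ_iff[symmetric])
  \<comment> \<open>With \<open>n\<close> fixed, Fatou's lemma along the subsequence bounds the
    distance from \<open>f n\<close> to the limit. The bound holds for every n \<ge> N, so the whole
    sequence converges and not only the subsequence.\<close>
  have key: "square_integrable (\<lambda>x. g x - f n x) \<and> norm (abs_L2 (\<lambda>x. g x - f n x)) \<le> e"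
    if N: "\<And>i j. i \<ge> N \<Longrightarrow> j \<ge> N \<Longrightarrow> norm (X i - X j) < e" and n: "n \<ge> N" for e N n
  proof -
    have e: "e > 0" using N[of N N] by simp
    have "(\<integral>\<^sup>+x. ennreal ((cmod (g x - f n x))\<^sup>2) \<partial>torus_measure)
        = (\<integral>\<^sup>+x. liminf (\<lambda>i. ennreal ((cmod (f (r i) x - f n x))\<^sup>2)) \<partial>torus_measure)"
    proof (rule nn_integral_cong_AE, use lim in eventually_elim)
      case (elim x)
      then have "(\<lambda>i. ennreal ((cmod (f (r i) x - f n x))\<^sup>2)) \<longlonglongrightarrow> ennreal ((cmod (g x - f n x))\<^sup>2)"
        by (intro tendsto_intros)
      then show ?case
        by (intro lim_imp_Liminf[symmetric]) simp
    qed
    also have "\<dots> \<le> liminf (\<lambda>i. \<integral>\<^sup>+x. ennreal ((cmod (f (r i) x - f n x))\<^sup>2) \<partial>torus_measure)"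
      by (rule nn_integral_liminf) measurable
    also have "\<dots> = liminf (\<lambda>i. ennreal ((norm (X (r i) - X n))\<^sup>2))"
      unfolding dX by (subst nn_integral_norm_abs_L2) (auto intro: square_integrable_diff f)
    also have "\<dots> \<le> liminf (\<lambda>i. ennreal (e\<^sup>2))"
    proof (rule Liminf_mono)
      show "\<forall>\<^sub>F i in sequentially. ennreal ((norm (X (r i) - X n))\<^sup>2) \<le> ennreal (e\<^sup>2)"
        using eventually_ge_at_top[of N]
      proof eventually_elim
        case (elim i)
        then have "r i \<ge> N" using seq_suble[OF r, of i] by simp
        from N[OF this n] show ?case
          by (intro ennreal_leI power_mono) auto
      qed
    qed
    also have "\<dots> = ennreal (e\<^sup>2)" by (simp add: Liminf_const)
    finally have le: "(\<integral>\<^sup>+x. ennreal ((cmod (g x - f n x))\<^sup>2) \<partial>torus_measure) \<le> ennreal (e\<^sup>2)" .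
    have "integrable torus_measure (\<lambda>x. (cmod (g x - f n x))\<^sup>2)"
      by (rule integrableI_bounded) (use le in \<open>auto simp: le_less_trans\<close>)
    then have sq: "square_integrable (\<lambda>x. g x - f n x)"
      by (simp add: square_integrable_def)
    have "(norm (abs_L2 (\<lambda>x. g x - f n x)))\<^sup>2 \<le> e\<^sup>2"
      using le by (simp add: nn_integral_norm_abs_L2[OF sq])
    then have "norm (abs_L2 (\<lambda>x. g x - f n x)) \<le> e"
      using e by (simp add: power_mono_iff)
    with sq show ?thesis by blast
  qed
  have sqg: "square_integrable g"
  proof -
    obtain N where "\<And>i j. i \<ge> N \<Longrightarrow> j \<ge> N \<Longrightarrow> norm (X i - X j) < 1"
      using X unfolding Cauchy_iff by (meson zero_less_one)
    then have "square_integrable (\<lambda>x. g x - f N x)"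
      using key[of N 1 N] by blast
    from square_integrable_add[OF this f[of N]] show ?thesis by simp
  qed
  have "X \<longlonglongrightarrow> abs_L2 g"
  proof (rule LIMSEQ_I)
    fix e :: real assume "e > 0"
    then obtain N where N: "\<And>i j. i \<ge> N \<Longrightarrow> j \<ge> N \<Longrightarrow> norm (X i - X j) < e / 2"
      using X unfolding Cauchy_iff by (meson half_gt_zero)
    have "norm (X n - abs_L2 g) < e" if "n \<ge> N" for n
    proof -
      have "norm (abs_L2 g - X n) \<le> e / 2"
        using key[OF N that] by (simp add: Xf abs_L2_diff[OF sqg f])
      then show ?thesis using \<open>e > 0\<close> by (simp add: norm_minus_commute)
    qed
    then show "\<exists>N. \<forall>n\<ge>N. norm (X n - abs_L2 g) < e" by blast
  qed
  then show "convergent X" by (rule convergentI)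
qed

section \<open>Complex inner product and complex Cauchy--Schwarz inequality\<close>

lemma cinner_diff_left: "cinner (x - y) z = cinner x z - cinner y z"
  by transfer (simp add: left_diff_distrib integrable_mult_cnj)

lemma cinner_diff_right: "cinner x (y - z) = cinner x y - cinner x z"
  by transfer (simp add: right_diff_distrib integrable_mult_cnj)

lemma cinner_scaleC_left: "cinner (c *\<^sub>C x) y = c * cinner x y"
  by transfer (simp add: mult.assoc)

lemma cnj_cinner: "cnj (cinner x y) = cinner y x"
proof transfer
  fix f g :: "'a torus \<Rightarrow> complex"
  have "cnj (\<integral>x. f x * cnj (g x) \<partial>torus_measure) = (\<integral>x. cnj (f x * cnj (g x)) \<partial>torus_measure)"
    by (rule Bochner_Integration.integral_cnj[symmetric])
  then show "cnj (\<integral>x. f x * cnj (g x) \<partial>torus_measure) = (\<integral>x. g x * cnj (f x) \<partial>torus_measure)"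
    by (simp add: mult.commute)
qed

lemma cinner_scaleC_right: "cinner x (c *\<^sub>C y) = cnj c * cinner x y"
  by (metis cinner_scaleC_left cnj_cinner complex_cnj_mult)

lemma cinner_self: "cinner x x = complex_of_real ((norm x)\<^sup>2)"
proof (rule complex_eqI)
  show "Re (cinner x x) = Re (complex_of_real ((norm x)\<^sup>2))"
    by (simp add: power2_norm_eq_inner inner_L2_def)
  show "Im (cinner x x) = Im (complex_of_real ((norm x)\<^sup>2))"
    using cnj_cinner[of x x] by (metis Im_complex_of_real Reals_cnj_iff complex_is_Real_iff)
qed

text \<open>Multiplying \<open>x\<close> by a unit phase makes the inner product real and
  nonnegative, so the real Cauchy--Schwarz inequality for \<open>inner\<close> applies.\<close>

lemma norm_cinner_le: "cmod (cinner x y) \<le> norm x * norm y"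
proof (cases "cinner x y = 0")
  case False
  define c where "c = cnj (sgn (cinner x y))"
  have "c * cinner x y = complex_of_real (cmod (cinner x y))"
    using False complex_norm_square[of "cinner x y"]
    by (simp add: c_def sgn_div_norm scaleR_conv_of_real power2_eq_square field_simps)
  then have "cmod (cinner x y) = inner (c *\<^sub>C x) y"
    by (simp add: inner_L2_def cinner_scaleC_left)
  also have "\<dots> \<le> norm (c *\<^sub>C x) * norm y"
    by (rule norm_cauchy_schwarz)
  also have "norm (c *\<^sub>C x) = norm x"
    using False by (simp add: norm_scaleC_L2 c_def norm_sgn)
  finally show ?thesis .
qed simp

lemma scaleC_diff_left: "(c - d) *\<^sub>C x = c *\<^sub>C x - d *\<^sub>C (x :: 'n::finite L2)"
  by (transfer, auto simp: L2_rel_def left_diff_distrib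
      intro!: square_integrable_diff square_integrable_cmult)

text \<open>The map is additive in \<open>y\<close> and bounded, hence Lipschitz. This gives
  measurability of the integrand of \<open>velocity\<close>.\<close>

lemma continuous_on_cinner_scaleC: "continuous_on A (\<lambda>y. cinner x y *\<^sub>C x)"
proof (rule lipschitz_on_continuous_on[OF lipschitz_onI])
  fix y z
  have "dist (cinner x y *\<^sub>C x) (cinner x z *\<^sub>C x) = cmod (cinner x (y - z)) * norm x"
    by (simp add: dist_norm cinner_diff_right norm_scaleC_L2 flip: scaleC_diff_left)
  also have "\<dots> \<le> (norm x * norm (y - z)) * norm x"
    by (intro mult_right_mono norm_cinner_le) simp
  finally show "dist (cinner x y *\<^sub>C x) (cinner x z *\<^sub>C x) \<le> (norm x)\<^sup>2 * dist y z"
    by (simp add: dist_norm power2_eq_square mult_ac)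
qed simp

section \<open>Contraction by the velocity field on the sphere\<close>

text \<open>With \<open>d = norm (\<phi> - \<psi>)\<close>, expansion leaves a term in the real
  parts of the couplings, at most \<open>- (1 - m) * d\<^sup>2\<close>, and a product of imaginary
  parts, at most \<open>m * d\<^sup>2\<close>. Together they give the factor
  \<open>1 - 2 * m\<close>.\<close>

lemma alignment_contracts:
  assumes unit: "norm \<phi> = 1" "norm \<psi> = 1" "norm \<eta> = 1"
    and near: "dist \<eta> \<phi> \<le> m" "dist \<eta> \<psi> \<le> m" and "m \<le> 2"
  shows "inner (\<phi> - \<psi>) ((\<eta> - cinner \<phi> \<eta> *\<^sub>C \<phi>) - (\<eta> - cinner \<psi> \<eta> *\<^sub>C \<psi>))
    \<le> - (1 - 2 * m) * (norm (\<phi> - \<psi>))\<^sup>2"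
proof -
  define z a b where "z = cinner \<phi> \<psi>" and "a = cinner \<phi> \<eta>" and "b = cinner \<psi> \<eta>"
  define d where "d = norm (\<phi> - \<psi>)"
  have self: "cinner \<phi> \<phi> = 1" "cinner \<psi> \<psi> = 1"
    using unit by (simp_all add: cinner_self)
  have z': "cinner \<psi> \<phi> = cnj z" by (simp add: z_def cnj_cinner)
  have dist2: "(norm (x - y))\<^sup>2 = 2 - 2 * Re (cinner x y)" if "norm x = 1" "norm y = 1" for x y :: "'a L2"
  proof -
    have "inner x x = 1" "inner y y = 1" using that by (simp_all flip: norm_eq_1)
    then have "(norm (x - y))\<^sup>2 = 2 - 2 * inner x y"
      by (simp add: power2_norm_eq_inner inner_diff_left inner_diff_right inner_commute[of y x])
    then show ?thesis by (simp add: inner_L2_def)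
  qed
  have "inner (\<phi> - \<psi>) ((\<eta> - a *\<^sub>C \<phi>) - (\<eta> - b *\<^sub>C \<psi>))
      = Re (cnj b * (z - 1) + cnj a * (cnj z - 1))"
    by (simp add: inner_L2_def cinner_diff_left cinner_diff_right cinner_scaleC_right self z'
        z_def[symmetric] algebra_simps)
  also have "\<dots> = - (1 - Re z) * (Re a + Re b) + Im z * (Im b - Im a)"
    by (simp add: algebra_simps)
  also have "1 - Re z = d\<^sup>2 / 2"
    using dist2[OF unit(1,2)] by (simp add: d_def z_def)
  finally have eq: "inner (\<phi> - \<psi>) ((\<eta> - a *\<^sub>C \<phi>) - (\<eta> - b *\<^sub>C \<psi>))
      = - (d\<^sup>2 / 2) * (Re a + Re b) + Im z * (Im b - Im a)" .
  have "m \<ge> 0" using near(1) zero_le_dist order_trans by blast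
  \<comment> \<open>For unit vectors the real part of the inner product is 1 minus half the squared
    distance, so \<open>Re a\<close> and \<open>Re b\<close> are at least
    \<open>1 - m\<^sup>2 / 2\<close>. The bound m \<le> 2 weakens this to \<open>1 - m\<close>,
    linear in \<open>m\<close> as the logistic equation requires.\<close>
  have "m\<^sup>2 \<le> 2 * m"
    using \<open>m \<ge> 0\<close> \<open>m \<le> 2\<close> by (simp add: power2_eq_square mult_right_mono)
  have "Re a \<ge> 1 - m"
    using dist2[OF unit(1,3)] power_mono[OF near(1), of 2] \<open>m\<^sup>2 \<le> 2 * m\<close>
    by (simp add: a_def dist_norm norm_minus_commute)
  moreover have "Re b \<ge> 1 - m"
    using dist2[OF unit(2,3)] power_mono[OF near(2), of 2] \<open>m\<^sup>2 \<le> 2 * m\<close>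
    by (simp add: b_def dist_norm norm_minus_commute)
  ultimately have re: "d\<^sup>2 / 2 * (Re a + Re b) \<ge> d\<^sup>2 / 2 * (2 - 2 * m)"
    by (intro mult_left_mono) auto
  \<comment> \<open>Replacing \<open>\<eta>\<close> by \<open>\<eta> - \<phi>\<close> in \<open>Im b - Im a\<close> costs \<open>- Im z\<close>, which has the good sign.\<close>
  have "Im b - Im a = - Im z + Im (cinner (\<psi> - \<phi>) (\<eta> - \<phi>))"
    by (simp add: a_def b_def cinner_diff_left cinner_diff_right self z')
  then have "Im z * (Im b - Im a) = - (Im z)\<^sup>2 + Im z * Im (cinner (\<psi> - \<phi>) (\<eta> - \<phi>))"
    by (simp only:) (simp add: power2_eq_square algebra_simps)
  also have "\<dots> \<le> \<bar>Im z\<bar> * \<bar>Im (cinner (\<psi> - \<phi>) (\<eta> - \<phi>))\<bar>"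
    using abs_ge_self[of "Im z * Im (cinner (\<psi> - \<phi>) (\<eta> - \<phi>))"] zero_le_power2[of "Im z"]
    unfolding abs_mult by linarith
  also have "\<dots> \<le> d * (d * m)"
  proof (rule mult_mono)
    have "Im z = Im (cinner (\<phi> - \<psi>) \<psi>)"
      by (simp add: cinner_diff_left self z_def)
    then have "\<bar>Im z\<bar> \<le> cmod (cinner (\<phi> - \<psi>) \<psi>)"
      by (metis abs_Im_le_cmod)
    also have "\<dots> \<le> d"
      using norm_cinner_le[of "\<phi> - \<psi>" \<psi>] unit by (simp add: d_def)
    finally show "\<bar>Im z\<bar> \<le> d" .
    have "\<bar>Im (cinner (\<psi> - \<phi>) (\<eta> - \<phi>))\<bar> \<le> cmod (cinner (\<psi> - \<phi>) (\<eta> - \<phi>))"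
      by (rule abs_Im_le_cmod)
    also have "\<dots> \<le> norm (\<psi> - \<phi>) * norm (\<eta> - \<phi>)"
      by (rule norm_cinner_le)
    also have "\<dots> \<le> d * m"
      using near(1) by (auto simp: d_def dist_norm norm_minus_commute intro!: mult_mono)
    finally show "\<bar>Im (cinner (\<psi> - \<phi>) (\<eta> - \<phi>))\<bar> \<le> d * m" .
  qed (auto simp: d_def)
  finally have "Im z * (Im b - Im a) \<le> d\<^sup>2 * m" by (simp add: power2_eq_square mult_ac)
  \<comment> \<open>These identities leave \<open>d\<^sup>2 * m\<close> as an atom for linear
    arithmetic.\<close>
  moreover have "d\<^sup>2 / 2 * (2 - 2 * m) = d\<^sup>2 - d\<^sup>2 * m"
      "- (d\<^sup>2 / 2) * (Re a + Re b) = - (d\<^sup>2 / 2 * (Re a + Re b))"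
      "- (1 - 2 * m) * d\<^sup>2 = - d\<^sup>2 + 2 * (d\<^sup>2 * m)"
    by (simp_all add: field_simps)
  ultimately show ?thesis
    using re unfolding a_def[symmetric] b_def[symmetric] eq d_def[symmetric] by linarith
qed

lemma borel_sphere_integrable:
  fixes f :: "'n::finite L2 \<Rightarrow> 'b::{banach, second_countable_topology}"
  assumes "\<mu> \<in> space (prob_algebra borel_sphere)" "continuous_on UNIV f"
    and bound: "\<And>\<phi>. norm \<phi> = 1 \<Longrightarrow> norm (f \<phi>) \<le> B"
  shows "integrable \<mu> f"
proof -
  interpret prob_space \<mu> using assms(1) by (simp add: space_prob_algebra)
  have sets: "sets \<mu> = sets borel_sphere" using assms(1) by (simp add: space_prob_algebra)
  have "f \<in> borel_measurable \<mu>"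
    unfolding measurable_cong_sets[OF sets refl]
    by (intro measurable_restrict_space1 borel_measurable_continuous_onI assms(2))
  then show ?thesis
    by (rule integrable_const_bound[rotated])
      (auto intro!: AE_I2 bound simp: sets_eq_imp_space_eq[OF sets] space_restrict_space)
qed

text \<open>The constant 2 is attained, at \<open>\<eta> = (- \<i>) *\<^sub>C \<phi>\<close>: the
  coefficient is the conjugate of the one in the orthogonal projection onto \<phi>, so the
  difference is not the complement of that projection.\<close>

lemma norm_alignment_le:
  assumes "norm \<phi> = 1" "norm \<eta> = 1"
  shows "norm (\<eta> - cinner \<phi> \<eta> *\<^sub>C \<phi>) \<le> 2"
proof -
  have "norm (\<eta> - cinner \<phi> \<eta> *\<^sub>C \<phi>) \<le> norm \<eta> + norm (cinner \<phi> \<eta> *\<^sub>C \<phi>)"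
    by (rule norm_triangle_ineq4)
  also have "\<dots> \<le> 2"
    using norm_cinner_le[of \<phi> \<eta>] assms by (simp add: norm_scaleC_L2)
  finally show ?thesis .
qed

lemma integrable_alignment:
  assumes "\<mu> \<in> space (prob_algebra borel_sphere)" "norm \<phi> = 1"
  shows "integrable \<mu> (\<lambda>\<eta>. \<eta> - cinner \<phi> \<eta> *\<^sub>C \<phi>)"
  by (rule borel_sphere_integrable[OF assms(1)])
    (auto intro!: continuous_intros continuous_on_cinner_scaleC norm_alignment_le assms(2))

lemma norm_velocity_le:
  assumes \<mu>: "\<mu> \<in> space (prob_algebra borel_sphere)" and "norm \<phi> = 1" "\<kappa> \<ge> 0"
  shows "norm (velocity \<kappa> \<mu> \<phi>) \<le> \<kappa>"
proof -
  interpret prob_space \<mu> using \<mu> by (simp add: space_prob_algebra)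
  have sp: "space \<mu> = sphere 0 1"
    using \<mu> sets_eq_imp_space_eq[of \<mu> borel_sphere] by (simp add: space_prob_algebra space_restrict_space)
  have "norm (\<integral>\<eta>. \<eta> - cinner \<phi> \<eta> *\<^sub>C \<phi> \<partial>\<mu>) \<le> (\<integral>\<eta>. norm (\<eta> - cinner \<phi> \<eta> *\<^sub>C \<phi>) \<partial>\<mu>)"
    by (rule integral_norm_bound)
  also have "\<dots> \<le> (\<integral>\<eta>. 2 \<partial>\<mu>)"
    using assms sp by (intro integral_mono integrable_norm integrable_alignment norm_alignment_le) auto
  finally have "\<kappa> / 2 * norm (\<integral>\<eta>. \<eta> - cinner \<phi> \<eta> *\<^sub>C \<phi> \<partial>\<mu>) \<le> \<kappa> / 2 * 2"
    using \<open>\<kappa> \<ge> 0\<close> by (intro mult_left_mono) (auto simp: prob_space)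
  then show ?thesis
    using \<open>\<kappa> \<ge> 0\<close> by (simp add: velocity_def)
qed

text \<open>The pointwise contraction passes to the average because \<open>inner\<close> commutes
  with the Bochner integral. Closeness is asked only almost everywhere, which is what a push-forward
  delivers.\<close>

lemma velocity_contracts:
  assumes \<mu>: "\<mu> \<in> space (prob_algebra borel_sphere)"
    and unit: "norm \<phi> = 1" "norm \<psi> = 1" and "\<kappa> \<ge> 0" "m \<le> 2"
    and near: "AE \<eta> in \<mu>. dist \<eta> \<phi> \<le> m \<and> dist \<eta> \<psi> \<le> m"
  shows "inner (\<phi> - \<psi>) (velocity \<kappa> \<mu> \<phi> - velocity \<kappa> \<mu> \<psi>)
    \<le> - (\<kappa> / 2 * (1 - 2 * m)) * (norm (\<phi> - \<psi>))\<^sup>2"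
proof -
  interpret prob_space \<mu> using \<mu> by (simp add: space_prob_algebra)
  have sp: "space \<mu> = sphere 0 1"
    using \<mu> sets_eq_imp_space_eq[of \<mu> borel_sphere] by (simp add: space_prob_algebra space_restrict_space)
  let ?F = "\<lambda>\<phi> \<eta>. \<eta> - cinner \<phi> \<eta> *\<^sub>C \<phi>"
  note int = integrable_alignment[OF \<mu> unit(1)] integrable_alignment[OF \<mu> unit(2)]
  have int': "integrable \<mu> (\<lambda>\<eta>. ?F \<phi> \<eta> - ?F \<psi> \<eta>)"
    by (rule Bochner_Integration.integrable_diff[OF int])
  have "(\<integral>\<eta>. ?F \<phi> \<eta> \<partial>\<mu>) - (\<integral>\<eta>. ?F \<psi> \<eta> \<partial>\<mu>) = (\<integral>\<eta>. ?F \<phi> \<eta> - ?F \<psi> \<eta> \<partial>\<mu>)"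
    by (rule Bochner_Integration.integral_diff[OF int, symmetric])
  then have "inner (\<phi> - \<psi>) ((\<integral>\<eta>. ?F \<phi> \<eta> \<partial>\<mu>) - (\<integral>\<eta>. ?F \<psi> \<eta> \<partial>\<mu>)) = (\<integral>\<eta>. inner (\<phi> - \<psi>) (?F \<phi> \<eta> - ?F \<psi> \<eta>) \<partial>\<mu>)"
    using integral_inner_right[OF int', of "\<phi> - \<psi>"] by simp
  also have "(\<integral>\<eta>. inner (\<phi> - \<psi>) (?F \<phi> \<eta> - ?F \<psi> \<eta>) \<partial>\<mu>) \<le> (\<integral>\<eta>. - (1 - 2 * m) * (norm (\<phi> - \<psi>))\<^sup>2 \<partial>\<mu>)"
  proof (rule integral_mono_AE)
    show "integrable \<mu> (\<lambda>\<eta>. inner (\<phi> - \<psi>) (?F \<phi> \<eta> - ?F \<psi> \<eta>))"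
      by (rule integrable_inner_right[OF int'])
    show "AE \<eta> in \<mu>. inner (\<phi> - \<psi>) (?F \<phi> \<eta> - ?F \<psi> \<eta>) \<le> - (1 - 2 * m) * (norm (\<phi> - \<psi>))\<^sup>2"
      using near AE_space
    proof eventually_elim
      case (elim \<eta>)
      then show ?case
        using sp \<open>m \<le> 2\<close> unit by (intro alignment_contracts) auto
    qed
  qed simp
  also have "(\<integral>\<eta>. - (1 - 2 * m) * (norm (\<phi> - \<psi>))\<^sup>2 \<partial>\<mu>) = - (1 - 2 * m) * (norm (\<phi> - \<psi>))\<^sup>2"
    by (simp add: prob_space)
  finally have le: "inner (\<phi> - \<psi>) ((\<integral>\<eta>. ?F \<phi> \<eta> \<partial>\<mu>) - (\<integral>\<eta>. ?F \<psi> \<eta> \<partial>\<mu>))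
    \<le> - (1 - 2 * m) * (norm (\<phi> - \<psi>))\<^sup>2" .
  have "inner (\<phi> - \<psi>) (velocity \<kappa> \<mu> \<phi> - velocity \<kappa> \<mu> \<psi>)
      = \<kappa> / 2 * inner (\<phi> - \<psi>) ((\<integral>\<eta>. ?F \<phi> \<eta> \<partial>\<mu>) - (\<integral>\<eta>. ?F \<psi> \<eta> \<partial>\<mu>))"
    unfolding velocity_def scaleR_diff_right[symmetric] by (simp only: inner_scaleR_right)
  also have "\<dots> \<le> \<kappa> / 2 * (- (1 - 2 * m) * (norm (\<phi> - \<psi>))\<^sup>2)"
    using le \<open>\<kappa> \<ge> 0\<close> by (intro mult_left_mono) auto
  also have "\<dots> = - (\<kappa> / 2 * (1 - 2 * m)) * (norm (\<phi> - \<psi>))\<^sup>2"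
    by (simp add: algebra_simps)
  finally show ?thesis .
qed

section \<open>Supports of measures and of their push-forwards\<close>

text \<open>By second countability, the points outside the support are covered by countably many
  basic open sets of measure zero.\<close>

lemma AE_supp:
  fixes \<mu> :: "'n::finite L2 measure"
  assumes sets: "sets \<mu> = sets borel_sphere"
  shows "AE \<phi> in \<mu>. \<phi> \<in> supp \<mu>"
proof -
  have sp: "space \<mu> = sphere 0 1"
    using sets_eq_imp_space_eq[OF sets] by (simp add: space_restrict_space)
  obtain \<B> :: "'n L2 set set" where \<B>: "countable \<B>" "topological_basis \<B>"
    using ex_countable_basis by blast
  let ?N = "{U \<in> \<B>. emeasure \<mu> (U \<inter> space \<mu>) = 0}"
  have "(\<Union>U\<in>?N. U \<inter> space \<mu>) \<in> null_sets \<mu>"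
  proof (rule null_sets_UN')
    show "countable ?N" using \<B>(1) by (rule countable_subset[rotated]) auto
    show "U \<inter> space \<mu> \<in> null_sets \<mu>" if "U \<in> ?N" for U
      using that topological_basis_open[OF \<B>(2), of U] unfolding null_sets_def sp
      by (auto simp: sets sets_restrict_space Int_commute)
  qed
  then show ?thesis
  proof (rule AE_I')
    show "{\<phi> \<in> space \<mu>. \<phi> \<notin> supp \<mu>} \<subseteq> (\<Union>U\<in>?N. U \<inter> space \<mu>)"
    proof
      fix \<phi> assume "\<phi> \<in> {\<phi> \<in> space \<mu>. \<phi> \<notin> supp \<mu>}"
      then obtain V where V: "\<phi> \<in> space \<mu>" "open V" "\<phi> \<in> V" "emeasure \<mu> (V \<inter> space \<mu>) = 0"
        by (auto simp: supp_def)
      obtain U where U: "U \<in> \<B>" "\<phi> \<in> U" "U \<subseteq> V"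
        using topological_basisE[OF \<B>(2) V(2,3)] by metis
      have "emeasure \<mu> (U \<inter> space \<mu>) \<le> emeasure \<mu> (V \<inter> space \<mu>)"
        using U V(2) by (intro emeasure_mono) (auto simp: sp sets sets_restrict_space)
      then show "\<phi> \<in> (\<Union>U\<in>?N. U \<inter> space \<mu>)"
        using U V by auto
    qed
  qed
qed

text \<open>An open set missing the image of the support pulls back into the complement of the
  support, which is null. It therefore cannot be a neighbourhood of a support point of the
  push-forward.\<close>

lemma supp_distr_subset_closure:
  assumes sets: "sets \<mu> = sets borel_sphere" and f [measurable]: "f \<in> borel_sphere \<rightarrow>\<^sub>M borel_sphere"
  shows "supp (distr \<mu> borel_sphere f) \<subseteq> closure (f ` supp \<mu>)"
proof
  fix \<eta> assume \<eta>: "\<eta> \<in> supp (distr \<mu> borel_sphere f)"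
  have fm: "f \<in> \<mu> \<rightarrow>\<^sub>M borel_sphere"
    using f by (simp add: measurable_cong_sets[OF sets refl])
  show "\<eta> \<in> closure (f ` supp \<mu>)"
    unfolding closure_iff_nhds_not_empty
  proof (intro allI impI notI)
    fix A V assume V: "V \<subseteq> A" "open V" "\<eta> \<in> V" and A: "f ` supp \<mu> \<inter> A = {}"
    let ?V = "V \<inter> space (distr \<mu> borel_sphere f)"
    have Vm: "?V \<in> sets borel_sphere"
      using V(2) by (auto simp: sets_restrict_space space_restrict_space)
    have "emeasure (distr \<mu> borel_sphere f) ?V > 0"
      using \<eta> V by (auto simp: supp_def)
    moreover have "emeasure (distr \<mu> borel_sphere f) ?V = emeasure \<mu> (f -` ?V \<inter> space \<mu>)"
      by (rule emeasure_distr[OF fm Vm])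
    moreover have "AE \<phi> in \<mu>. \<phi> \<notin> f -` ?V \<inter> space \<mu>"
      using AE_supp[OF sets] by eventually_elim (use V A in auto)
    then have "emeasure \<mu> (f -` ?V \<inter> space \<mu>) = 0"
      using measurable_sets[OF fm Vm] by (simp add: AE_iff_null_sets null_setsD1)
    ultimately show False by simp
  qed
qed

section \<open>Gronwall's inequality and comparison with the logistic equation\<close>

text \<open>The product of \<open>f\<close> with the exponential of a primitive of \<open>g\<close>
  is nonincreasing. The rate \<open>g\<close> may have either sign. Derivatives are asked in the
  open interval only, since characteristics have a one-sided derivative at time 0.\<close>

lemma gronwall_exp:
  fixes f g :: "real \<Rightarrow> real"
  assumes "t \<ge> 0" and f: "continuous_on {0..t} f" and g: "continuous_on {0..t} g"
    and f': "\<And>s. 0 < s \<Longrightarrow> s < t \<Longrightarrow> (f has_real_derivative f' s) (at s) \<and> f' s \<le> - g s * f s"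
  shows "f t \<le> f 0 * exp (- integral {0..t} g)"
proof -
  define G where "G s = integral {0..s} g" for s
  have "f t * exp (G t) \<le> f 0 * exp (G 0)"
  proof (rule DERIV_nonpos_imp_decreasing_open[OF \<open>t \<ge> 0\<close>])
    fix s assume s: "0 < s" "s < t"
    have "(G has_real_derivative g s) (at s within {0..t})"
      unfolding G_def using g s by (intro integral_has_real_derivative) auto
    then have [derivative_intros]: "(G has_real_derivative g s) (at s)"
      using s by (simp add: at_within_Icc_at)
    note [derivative_intros] = conjunct1[OF f'[OF s]]
    have "((\<lambda>s. f s * exp (G s)) has_real_derivative (f' s + g s * f s) * exp (G s)) (at s)"
      by (auto intro!: derivative_eq_intros simp: algebra_simps)
    moreover have "(f' s + g s * f s) * exp (G s) \<le> 0"
      using f'[OF s] by (intro mult_nonpos_nonneg) auto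
    ultimately show "\<exists>y. ((\<lambda>s. f s * exp (G s)) has_real_derivative y) (at s) \<and> y \<le> 0" by blast
  next
    have "continuous_on {0..t} G"
      unfolding G_def using g by (intro indefinite_integral_continuous_1 integrable_continuous_real)
    then show "continuous_on {0..t} (\<lambda>s. f s * exp (G s))"
      using f by (intro continuous_intros)
  qed
  then show ?thesis
    by (simp add: G_def exp_minus field_simps)
qed

text \<open>The envelope \<open>u = m 0 * exp (- \<integral> k (1 - 2 m))\<close> dominates \<open>m\<close>, hence is a subsolution of
  \<open>u' = - k u (1 - 2 u)\<close>, an equation that is linear in \<open>1 / u - 2\<close>.\<close>

lemma logistic_comparison:
  fixes m :: "real \<Rightarrow> real"
  assumes m: "continuous_on {0..} m" "0 \<le> m 0" "m 0 < 1 / 2" and "k \<ge> 0" "t \<ge> 0"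
    and bound: "\<And>t. t \<ge> 0 \<Longrightarrow> m t \<le> m 0 * exp (- integral {0..t} (\<lambda>s. k * (1 - 2 * m s)))"
  shows "m t \<le> m 0 / ((1 - 2 * m 0) * exp (k * t) + 2 * m 0)"
proof (cases "m 0 = 0")
  case True
  then show ?thesis using bound[OF \<open>t \<ge> 0\<close>] by simp
next
  case False
  with m have pos: "m 0 > 0" by simp
  define g where "g s = k * (1 - 2 * m s)" for s
  define G where "G s = integral {0..s} g" for s
  \<comment> \<open>\<open>v\<close> is the reciprocal of the envelope, so
    \<open>m s * v s \<le> 1\<close> and its derivative \<open>k * (v - 2 * m * v)\<close> is at
    least \<open>k * (v - 2)\<close>.\<close>
  define v where "v s = exp (G s) / m 0" for s
  have g: "continuous_on {0..t} g"
    unfolding g_def by (intro continuous_intros continuous_on_subset[OF m(1)]) auto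
  have G: "continuous_on {0..t} G"
    unfolding G_def using g by (intro indefinite_integral_continuous_1 integrable_continuous_real)
  have vpos: "v s > 0" for s using pos by (simp add: v_def)
  have mv: "m s \<le> 1 / v s" if "s \<ge> 0" for s
    using bound[OF that] pos by (simp add: v_def G_def g_def[abs_def] exp_minus divide_simps)
  \<comment> \<open>The lower bound for \<open>v - 2\<close> comes from Gronwall's inequality for
    \<open>2 - v\<close> with the constant rate \<open>- k\<close>.\<close>
  have "2 - v t \<le> (2 - v 0) * exp (- integral {0..t} (\<lambda>_. - k))"
  proof (rule gronwall_exp[OF \<open>t \<ge> 0\<close>, where f' = "\<lambda>s. - g s * v s"])
    show "continuous_on {0..t} (\<lambda>s. 2 - v s)"
      unfolding v_def using pos by (intro continuous_intros G) auto
    fix s assume s: "0 < s" "s < t"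
    have "(G has_real_derivative g s) (at s within {0..t})"
      unfolding G_def using g s by (intro integral_has_real_derivative) auto
    then have "(G has_real_derivative g s) (at s)"
      using s by (simp add: at_within_Icc_at)
    then have "((\<lambda>s. 2 - v s) has_real_derivative - g s * v s) (at s)"
      unfolding v_def using pos by (auto intro!: derivative_eq_intros)
    moreover have "m s * v s \<le> 1"
      using mv[of s] s vpos[of s] by (simp add: field_simps)
    then have "k * (2 * (m s * v s)) \<le> k * 2"
      using \<open>k \<ge> 0\<close> by (intro mult_left_mono) auto
    then have "- g s * v s \<le> - (- k) * (2 - v s)"
      by (simp add: g_def algebra_simps)
    ultimately show "((\<lambda>s. 2 - v s) has_real_derivative - g s * v s) (at s)
        \<and> - g s * v s \<le> - (- k) * (2 - v s)" by blast
  qed (intro continuous_intros)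
  then have "(1 / m 0 - 2) * exp (k * t) + 2 \<le> v t"
    using \<open>t \<ge> 0\<close> by (simp add: v_def G_def algebra_simps)
  \<comment> \<open>Here \<open>m 0 < 1 / 2\<close> enters: the lower bound for \<open>v t\<close>
    is positive, so reciprocals may be taken.\<close>
  moreover have "(1 / m 0 - 2) * exp (k * t) + 2 > 0"
    using m pos by (intro add_nonneg_pos mult_nonneg_nonneg) (auto simp: field_simps)
  ultimately have "1 / v t \<le> 1 / ((1 / m 0 - 2) * exp (k * t) + 2)"
    by (intro divide_left_mono mult_pos_pos vpos) auto
  also have "\<dots> = m 0 / ((1 - 2 * m 0) * exp (k * t) + 2 * m 0)"
  proof -
    have "(1 - 2 * m 0) * exp (k * t) + 2 * m 0 = m 0 * ((1 / m 0 - 2) * exp (k * t) + 2)"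
      using pos by (simp add: field_simps)
    then show ?thesis using pos by simp
  qed
  finally show ?thesis using mv[OF \<open>t \<ge> 0\<close>] by linarith
qed

section \<open>Diameter of the transported support and conclusion\<close>

text \<open>Moving both endpoints by at most \<open>e\<close> changes their distance by at most
  \<open>2 * e\<close>. A modulus of continuity of the flow in time, uniform over \<open>E\<close>,
  thus passes to the diameter.\<close>

lemma diameter_image_le:
  fixes f g :: "'a \<Rightarrow> 'b::real_normed_vector"
  assumes "bounded (g ` E)" and close: "\<And>x. x \<in> E \<Longrightarrow> dist (f x) (g x) \<le> e" and "e \<ge> 0"
  shows "diameter (f ` E) \<le> diameter (g ` E) + 2 * e"
proof (rule diameter_le)
  show "f ` E \<noteq> {} \<or> 0 \<le> diameter (g ` E) + 2 * e"
    using assms diameter_ge_0 by fastforce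
  fix x y assume "x \<in> f ` E" "y \<in> f ` E"
  then obtain a b where ab: "a \<in> E" "b \<in> E" "x = f a" "y = f b" by blast
  have "dist (g a) (g b) \<le> diameter (g ` E)"
    using ab assms(1) by (intro diameter_bounded_bound) auto
  moreover have "dist (f a) (f b) \<le> dist (f a) (g a) + dist (g a) (g b) + dist (f b) (g b)"
    using dist_triangle[of "f a" "f b" "g a"] dist_triangle[of "g a" "f b" "g b"]
    by (simp add: dist_commute)
  ultimately show "norm (x - y) \<le> diameter (g ` E) + 2 * e"
    using close[of a] close[of b] ab by (simp add: dist_norm)
qed

theorem theorem5p1:
  fixes \<kappa> :: real
    and \<rho>0 :: "'n::finite L2 measure"
    and \<rho> :: "real \<Rightarrow> 'n L2 measure"
  assumes "\<kappa> > 0"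
    and "\<rho>0 \<in> space (prob_algebra borel_sphere)"
    and "supp_diameter \<rho>0 < 1 / 2"
    and "lagrangian_weak_solution \<kappa> \<rho>0 \<rho>"
  shows "(\<exists>C l. l > 0 \<and> (\<forall>t\<ge>0. supp_diameter (\<rho> t) \<le> C * exp (- l * t))) \<and>
    (\<forall>t\<ge>0. supp_diameter (\<rho> t) \<le>
       supp_diameter \<rho>0 / ((1 - 2 * supp_diameter \<rho>0) * exp (\<kappa> / 2 * t) + 2 * supp_diameter \<rho>0))"
proof -
  have \<rho>: "\<rho> t \<in> space (prob_algebra borel_sphere)" if "t \<ge> 0" for t
    using assms(4) that unfolding lagrangian_weak_solution_def by blast
  obtain S where S: "characteristic_flow \<kappa> \<rho> S"
    and Sm: "\<And>t. t \<ge> 0 \<Longrightarrow> S t \<in> borel_sphere \<rightarrow>\<^sub>M borel_sphere"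
    and push: "\<And>t. t \<ge> 0 \<Longrightarrow> \<rho> t = distr \<rho>0 borel_sphere (S t)"
    using assms(4) unfolding lagrangian_weak_solution_def by blast
  have sets0: "sets \<rho>0 = sets borel_sphere"
    using assms(2) by (simp add: space_prob_algebra)
  define E where "E = supp \<rho>0"
  have E: "norm \<phi> = 1" if "\<phi> \<in> E" for \<phi>
    using that sets_eq_imp_space_eq[OF sets0] by (simp add: E_def supp_def space_restrict_space)
  have S0: "S 0 \<phi> = \<phi>" if "\<phi> \<in> E" for \<phi>
    using S E[OF that] unfolding characteristic_flow_def by simp
  have unit: "norm (S t \<phi>) = 1" if "\<phi> \<in> E" "t \<ge> 0" for \<phi> t
    using S E[OF that(1)] that(2) unfolding characteristic_flow_def by simp
  have deriv: "((\<lambda>s. S s \<phi>) has_vector_derivative velocity \<kappa> (\<rho> t) (S t \<phi>)) (at t within {0..})"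
    if "\<phi> \<in> E" "t \<ge> 0" for \<phi> t
    using S E[OF that(1)] that(2) unfolding characteristic_flow_def by simp
  \<comment> \<open>Speeds are at most \<kappa> by \<open>norm_velocity_le\<close>. The constant is
    the same for every \<phi> in \<open>E\<close>, as the supremum over pairs demands.\<close>
  have Lip: "dist (S s \<phi>) (S t \<phi>) \<le> \<kappa> * \<bar>s - t\<bar>" if "\<phi> \<in> E" "s \<ge> 0" "t \<ge> 0" for \<phi> s t
  proof -
    have "norm (S s \<phi> - S t \<phi>) \<le> \<kappa> * norm (s - t)"
    proof (rule differentiable_bound[of "{0..}" _ "\<lambda>x h. h *\<^sub>R velocity \<kappa> (\<rho> x) (S x \<phi>)"])
      fix x :: real assume "x \<in> {0..}"
      then show "((\<lambda>s. S s \<phi>) has_derivative (\<lambda>h. h *\<^sub>R velocity \<kappa> (\<rho> x) (S x \<phi>))) (at x within {0..})"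
        using deriv[OF that(1), of x] by (simp add: has_vector_derivative_def)
      show "onorm (\<lambda>h. h *\<^sub>R velocity \<kappa> (\<rho> x) (S x \<phi>)) \<le> \<kappa>"
        using norm_velocity_le[OF \<rho> unit[OF that(1)], of x x \<kappa>] \<open>x \<in> {0..}\<close> \<open>\<kappa> > 0\<close>
        by (intro onorm_bound) (auto simp: mult_left_mono mult.commute[of \<kappa>])
    qed (use that in auto)
    then show ?thesis by (simp add: dist_norm)
  qed
  define m where "m t = diameter (S t ` E)" for t
  have bdd: "bounded (S t ` E)" if "t \<ge> 0" for t
    using unit that by (intro boundedI[of _ 1]) auto
  have m_ge: "dist (S t \<phi>) (S t \<psi>) \<le> m t" if "\<phi> \<in> E" "\<psi> \<in> E" "t \<ge> 0" for \<phi> \<psi> t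
    unfolding m_def using that bdd by (intro diameter_bounded_bound) auto
  have m_le2: "m t \<le> 2" if "t \<ge> 0" for t
    unfolding m_def
  proof (rule diameter_le)
    fix x y assume "x \<in> S t ` E" "y \<in> S t ` E"
    then show "norm (x - y) \<le> 2"
      using unit that norm_triangle_ineq4[of x y] by auto
  qed simp
  have m_lip: "(2 * \<kappa>)-lipschitz_on {0..} m"
  proof (rule lipschitz_onI)
    fix s t :: real assume st: "s \<in> {0..}" "t \<in> {0..}"
    then have "m s \<le> m t + 2 * (\<kappa> * \<bar>s - t\<bar>)" "m t \<le> m s + 2 * (\<kappa> * \<bar>t - s\<bar>)"
      unfolding m_def using \<open>\<kappa> > 0\<close> by (auto intro!: diameter_image_le bdd Lip)
    then show "dist (m s) (m t) \<le> 2 * \<kappa> * dist s t"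
      by (simp add: dist_real_def abs_minus_commute)
  qed (use \<open>\<kappa> > 0\<close> in simp)
  then have m_cont: "continuous_on {0..} m"
    by (rule lipschitz_on_continuous_on)
  have m0: "m 0 = supp_diameter \<rho>0"
    using S0 by (simp add: m_def supp_diameter_def E_def[symmetric])
  have "bounded E" using E by (intro boundedI[of _ 1]) auto
  then have m0_ge: "m 0 \<ge> 0"
    unfolding m0 supp_diameter_def E_def by (rule diameter_ge_0)

  \<comment> \<open>Almost every initial point lies in \<open>E\<close>, so its image at time
    \<open>t\<close> is within \<open>m t\<close> of the image of any point of \<open>E\<close>. The
    push-forward turns this into a statement about \<open>\<rho> t\<close>.\<close>
  have near: "AE \<eta> in \<rho> t. dist \<eta> (S t \<phi>) \<le> m t \<and> dist \<eta> (S t \<psi>) \<le> m t"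
    if "\<phi> \<in> E" "\<psi> \<in> E" "t \<ge> 0" for \<phi> \<psi> t
  proof -
    have fm: "S t \<in> \<rho>0 \<rightarrow>\<^sub>M borel_sphere"
      using Sm[OF that(3)] by (simp add: measurable_cong_sets[OF sets0 refl])
    have "AE \<eta> in \<rho>0. dist (S t \<eta>) (S t \<phi>) \<le> m t \<and> dist (S t \<eta>) (S t \<psi>) \<le> m t"
      using AE_supp[OF sets0] by eventually_elim (use m_ge that in \<open>auto simp: E_def[symmetric]\<close>)
    moreover have "{\<eta> \<in> space borel_sphere. dist \<eta> (S t \<phi>) \<le> m t \<and> dist \<eta> (S t \<psi>) \<le> m t}
        \<in> sets borel_sphere"
    proof -
      have "closed {\<eta>. dist \<eta> (S t \<phi>) \<le> m t \<and> dist \<eta> (S t \<psi>) \<le> m t}"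
        by (intro closed_Collect_conj closed_Collect_le continuous_intros)
      then have "sphere 0 1 \<inter> {\<eta>. dist \<eta> (S t \<phi>) \<le> m t \<and> dist \<eta> (S t \<psi>) \<le> m t} \<in> sets borel_sphere"
        by (auto simp: sets_restrict_space)
      then show ?thesis by (simp add: space_restrict_space Int_def)
    qed
    ultimately show ?thesis
      unfolding push[OF that(3)] using fm by (subst AE_distr_iff) auto
  qed

  have pair: "dist (S t \<phi>) (S t \<psi>) \<le> m 0 * exp (- integral {0..t} (\<lambda>s. \<kappa> / 2 * (1 - 2 * m s)))"
    if E\<phi>: "\<phi> \<in> E" and E\<psi>: "\<psi> \<in> E" and t: "t \<ge> 0" for \<phi> \<psi> t
  proof -
    define w where "w s = S s \<phi> - S s \<psi>" for s
    define w' where "w' s = velocity \<kappa> (\<rho> s) (S s \<phi>) - velocity \<kappa> (\<rho> s) (S s \<psi>)" for s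
    have "(w has_vector_derivative w' s) (at s within {0..})" if "s \<ge> 0" for s
      unfolding w_def w'_def by (intro derivative_intros deriv E\<phi> E\<psi> that)
    then have w: "(w has_derivative (\<lambda>h. h *\<^sub>R w' s)) (at s within {0..})" if "s \<ge> 0" for s
      using that by (simp add: has_vector_derivative_def)
    \<comment> \<open>The squared norm is differentiable even where the two characteristics meet.
      Squaring doubles the rate from \<open>\<kappa> / 2\<close> to \<kappa>, and the square root
      taken afterwards halves it again.\<close>
    have "inner (w t) (w t) \<le> inner (w 0) (w 0) * exp (- integral {0..t} (\<lambda>s. \<kappa> * (1 - 2 * m s)))"
    proof (rule gronwall_exp[OF t, where f' = "\<lambda>s. 2 * inner (w s) (w' s)"])
      have "continuous_on {0..} w"
        using w by (auto simp: continuous_on_eq_continuous_within intro: has_derivative_continuous)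
      then show "continuous_on {0..t} (\<lambda>s. inner (w s) (w s))"
        by (intro continuous_intros) (auto intro: continuous_on_subset)
      show "continuous_on {0..t} (\<lambda>s. \<kappa> * (1 - 2 * m s))"
        by (intro continuous_intros continuous_on_subset[OF m_cont]) auto
      fix s assume s: "0 < s" "s < t"
      have "at s within {0..} = at s"
        using s by (intro at_within_interior) (simp add: interior_real_atLeast)
      then have "(w has_derivative (\<lambda>h. h *\<^sub>R w' s)) (at s)"
        using w[of s] s by simp
      from has_derivative_inner[OF this this]
      have "((\<lambda>s. inner (w s) (w s)) has_real_derivative 2 * inner (w s) (w' s)) (at s)"
        by (simp add: has_field_derivative_def inner_commute mult_commute_abs
            flip: distrib_left)
      moreover have "inner (w s) (w' s) \<le> - (\<kappa> / 2 * (1 - 2 * m s)) * (norm (w s))\<^sup>2"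
        unfolding w_def w'_def using s \<open>\<kappa> > 0\<close> E\<phi> E\<psi>
        by (intro velocity_contracts \<rho> unit near m_le2) auto
      ultimately show "((\<lambda>s. inner (w s) (w s)) has_real_derivative 2 * inner (w s) (w' s)) (at s)
          \<and> 2 * inner (w s) (w' s) \<le> - (\<kappa> * (1 - 2 * m s)) * inner (w s) (w s)"
        by (simp add: power2_norm_eq_inner)
    qed
    also have "integral {0..t} (\<lambda>s. \<kappa> * (1 - 2 * m s)) = 2 * integral {0..t} (\<lambda>s. \<kappa> / 2 * (1 - 2 * m s))"
      by (subst integral_mult_right[symmetric]) simp
    finally have "(norm (w t))\<^sup>2 \<le> (norm (w 0) * exp (- integral {0..t} (\<lambda>s. \<kappa> / 2 * (1 - 2 * m s))))\<^sup>2"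
      by (simp add: power2_norm_eq_inner power_mult_distrib exp_double[symmetric])
    then have "norm (w t) \<le> norm (w 0) * exp (- integral {0..t} (\<lambda>s. \<kappa> / 2 * (1 - 2 * m s)))"
      by (rule power2_le_imp_le) simp
    also have "norm (w 0) \<le> m 0"
      using m_ge[OF E\<phi> E\<psi>, of 0] by (simp add: w_def dist_norm)
    finally show ?thesis by (simp add: w_def dist_norm mult_right_mono)
  qed
  \<comment> \<open>The bound in \<open>pair\<close> does not depend on the pair, so it survives the
    supremum that defines \<open>m t\<close>.\<close>
  have "m t \<le> m 0 * exp (- integral {0..t} (\<lambda>s. \<kappa> / 2 * (1 - 2 * m s)))" if "t \<ge> 0" for t
    unfolding m_def[of t] using pair that m0_ge by (intro diameter_le) (auto simp: dist_norm)
  then have m_logistic: "m t \<le> m 0 / ((1 - 2 * m 0) * exp (\<kappa> / 2 * t) + 2 * m 0)" if "t \<ge> 0" for t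
    using assms(1,3) m0 m0_ge m_cont that by (intro logistic_comparison) auto
  have "supp_diameter (\<rho> t) \<le> m t" if "t \<ge> 0" for t
  proof -
    have "supp (\<rho> t) \<subseteq> closure (S t ` E)"
      unfolding push[OF that] E_def by (rule supp_distr_subset_closure[OF sets0 Sm[OF that]])
    then have "supp_diameter (\<rho> t) \<le> diameter (closure (S t ` E))"
      unfolding supp_diameter_def using bdd[OF that] by (intro diameter_subset) auto
    then show ?thesis
      by (simp add: m_def diameter_closure bdd[OF that])
  qed
  then have bound: "supp_diameter (\<rho> t) \<le> m 0 / ((1 - 2 * m 0) * exp (\<kappa> / 2 * t) + 2 * m 0)"
    if "t \<ge> 0" for t
    using m_logistic that by (meson order_trans)
  \<comment> \<open>Dropping \<open>2 * m 0\<close> from the denominator gives plain exponential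
    decay, with \<open>C = m 0 / (1 - 2 * m 0)\<close> and \<open>l = \<kappa> / 2\<close>.\<close>
  have "supp_diameter (\<rho> t) \<le> m 0 / (1 - 2 * m 0) * exp (- (\<kappa> / 2) * t)" if "t \<ge> 0" for t
  proof -
    have "m 0 / ((1 - 2 * m 0) * exp (\<kappa> / 2 * t) + 2 * m 0) \<le> m 0 / ((1 - 2 * m 0) * exp (\<kappa> / 2 * t))"
      using m0 m0_ge assms(3) by (intro divide_left_mono mult_pos_pos add_pos_nonneg) auto
    also have "\<dots> = m 0 / (1 - 2 * m 0) * exp (- (\<kappa> / 2) * t)"
      by (simp add: exp_minus field_simps)
    finally show ?thesis using bound[OF that] by linarith
  qed
  then show ?thesis
    using bound \<open>\<kappa> > 0\<close> unfolding m0[symmetric] by (metis half_gt_zero)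
qed

end
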